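(* Let $A,B,C,D,E,F$ be constants with $AC\neq 0$ such that the quadratic equation in $y$ $$Ay^2+2Bxy+Cx^2+2Dy+2Ex+F=0$$ has two roots $\varphi_1(x),\varphi_2(x)$ which are not identically equal, and let $$(\mathcal{D}f)(x)=\frac{f(\varphi_2(x))-f(\varphi_1(x))}{\varphi_2(x)-\varphi_1(x)},\qquad (\mathcal{M}f)(x)=\frac{f(\varphi_1(x))+f(\varphi_2(x))}{2}.$$ Let $\mu$ be a positive measure on the real line with infinite support and finite moments, let $(p_n)_{n\ge 0}$ be its orthonormal polynomials, with three-term recurrence $a_{n+1}p_{n+1}(x)=(x-b_n)p_n(x)-a_np_{n-1}(x)$, and let $S$ be the Stieltjes function of $\mu$. Suppose that for each $n\ge 1$ the polynomial $p_n$ satisfies a (nontrivial) linear first-order difference relation connecting $p_n$ with $p_{n-1}$, $$W_n(x)\,(\mathcal{D}p_n)(x)=\Omega_n(x)\,(\mathcal{M}p_n)(x)-a_n\Theta_n(x)\,(\mathcal{M}p_{n-1})(x),$$ where $W_n,\Omega_n,\Theta_n$ are polynomials, not all zero, of fixed (independent of $n$) degrees. Then the orthogonal polynomials $p_n$ are $\mathcal{D}$-semi-classical, i.e., there exist polynomials $W,V,U$, not all zero, such that $$W(x)\,(\mathcal{D}S)(x)=2V(x)\,(\mathcal{M}S)(x)+U(x).$$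
   Context: The operator $\mathcal{D}$ is the divided difference operator attached to the conic $Ay^2+2Bxy+Cx^2+2Dy+2Ex+F=0$; it maps polynomials to polynomials of lower degree, and $\mathcal{M}$ (the arithmetic mean operator) maps polynomials to polynomials, because symmetric polynomials in $\varphi_1(x),\varphi_2(x)$ are polynomials in $x$. The orthonormal polynomials satisfy $\int p_np_m\,d\mu=\delta_{nm}$, with $p_n$ of degree $n$ and leading coefficient $\gamma_n>0$; the recurrence coefficients are $a_n=\gamma_{n-1}/\gamma_n>0$ for $n\ge1$ and $b_n=\int x\,p_n(x)^2\,d\mu(x)$ (with $p_{-1}=0$). The Stieltjes function of $\mu$ is $$S(x)=\int_{\mathrm{supp}\,\mu}\frac{d\mu(t)}{x-t}=\sum_{k=0}^{\infty}\frac{\mu_k}{x^{k+1}},\qquad \mu_k=\int t^k\,d\mu(t),$$ the series being understood as the expansion at infinity. The equation $W\,\mathcal{D}S=2V\,\mathcal{M}S+U$ is understood as an identity of expansions at $x=\infty$, obtained by substituting in $S$ the expansions of $\varphi_1(x),\varphi_2(x)$ in descending (possibly half-integer) powers of $x$; both roots grow linearly at infinity because $AC\ne0$. If $\mathrm{supp}\,\mu$ is compact, this is an identity of functions for all complex $x$ of sufficiently large modulus. *)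

theory Defs
  imports "HOL-Analysis.Analysis" "HOL-Complex_Analysis.Laurent_Convergence"
begin

text \<open>
  Expansions at $x = \infty$ in descending, possibly half-integer, powers of $x$ are formal Laurent
  series over the complex numbers in the variable $t = x^{-1/2}$. Thus \<open>fls_X\<close> is $t$, the
  subdegree is minus twice the order of growth in $x$, and the function $x$ itself is $t^{-2}$.
\<close>

definition x_inf :: "complex fls" where
  "x_inf = fls_X_inv ^ 2"

definition conic_expr :: "complex \<Rightarrow> complex \<Rightarrow> complex \<Rightarrow> complex \<Rightarrow> complex \<Rightarrow> complex \<Rightarrow>
    complex fls \<Rightarrow> complex fls \<Rightarrow> complex fls" where
  "conic_expr A B C D E F x y =
     fls_const A * y ^ 2 + 2 * fls_const B * x * y + fls_const C * x ^ 2
     + 2 * fls_const D * y + 2 * fls_const E * x + fls_const F"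

text \<open>
  The two operators, for \<open>f1\<close>, \<open>f2\<close> the values of a function at the two roots \<open>y1\<close>, \<open>y2\<close>.
\<close>

definition divided_difference :: "'a::field \<Rightarrow> 'a \<Rightarrow> ('a \<Rightarrow> 'a) \<Rightarrow> 'a" where
  "divided_difference y1 y2 f = (f y2 - f y1) / (y2 - y1)"

definition arithmetic_mean :: "'a::field \<Rightarrow> 'a \<Rightarrow> ('a \<Rightarrow> 'a) \<Rightarrow> 'a" where
  "arithmetic_mean y1 y2 f = (f y1 + f y2) / 2"

definition poly_at :: "complex poly \<Rightarrow> complex fls \<Rightarrow> complex fls" where
  "poly_at P y = poly (map_poly fls_const P) y"

definition moment :: "real measure \<Rightarrow> nat \<Rightarrow> real" where
  "moment \<mu> k = (\<integral>t. t ^ k \<partial>\<mu>)"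

definition measure_support :: "real measure \<Rightarrow> real set" where
  "measure_support \<mu> = {x. \<forall>U. open U \<and> x \<in> U \<longrightarrow> emeasure \<mu> U > 0}"

text \<open>
  The series $S(y) = \sum_k \mu_k / y^{k+1}$ as a power series in $1/y$. Substituting an expansion
  \<open>y\<close> that tends to infinity is the composition of this power series with \<open>inverse y\<close>, which then
  has positive subdegree, so that taking the regular part loses nothing; see
  \<open>conic_root_subdegree\<close> below for the roots of the conic.
\<close>

definition stieltjes_fps :: "real measure \<Rightarrow> complex fps" where
  "stieltjes_fps \<mu> = Abs_fps (\<lambda>n. if n = 0 then 0 else complex_of_real (moment \<mu> (n - 1)))"

definition stieltjes_at :: "real measure \<Rightarrow> complex fls \<Rightarrow> complex fls" where
  "stieltjes_at \<mu> y = fps_to_fls (fps_compose (stieltjes_fps \<mu>) (fls_regpart (inverse y)))"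

definition orthonormal_polys :: "real measure \<Rightarrow> (nat \<Rightarrow> real poly) \<Rightarrow> bool" where
  "orthonormal_polys \<mu> p \<longleftrightarrow>
     (\<forall>n. degree (p n) = n \<and> lead_coeff (p n) > 0) \<and>
     (\<forall>n m. (\<integral>t. poly (p n) t * poly (p m) t \<partial>\<mu>) = (if n = m then 1 else 0))"

text \<open>
  The coefficient $a_n = \gamma_{n-1}/\gamma_n$ of the recurrence
  $a_{n+1} p_{n+1} = (x - b_n) p_n - a_n p_{n-1}$, meaningful only for $n \ge 1$.
\<close>

definition rec_a :: "(nat \<Rightarrow> real poly) \<Rightarrow> nat \<Rightarrow> real" where
  "rec_a p n = lead_coeff (p (n - 1)) / lead_coeff (p n)"

definition D_semi_classical :: "complex fls \<Rightarrow> complex fls \<Rightarrow> real measure \<Rightarrow> bool" where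
  "D_semi_classical y1 y2 \<mu> \<longleftrightarrow>
     (\<exists>W V U :: complex poly. \<not> (W = 0 \<and> V = 0 \<and> U = 0) \<and>
        poly_at W x_inf * divided_difference y1 y2 (stieltjes_at \<mu>) =
          2 * poly_at V x_inf * arithmetic_mean y1 y2 (stieltjes_at \<mu>) + poly_at U x_inf)"

lemma x_inf_mult: "x_inf * f = fls_shift 2 f"
  by (simp add: x_inf_def fls_X_inv_power_times_conv_shift)

lemma conic_expand:
  "conic_expr A B C D E F x_inf y =
     fls_const A * y ^ 2 + fls_const (2 * B) * fls_shift 2 y + fls_const C * fls_shift 4 1
     + fls_const (2 * D) * y + fls_const (2 * E) * fls_shift 2 1 + fls_const F"
proof -
  have 1: "x_inf = fls_shift 2 1" using x_inf_mult[of 1] by simp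
  have 2: "x_inf ^ 2 = fls_shift 4 1"
    unfolding power2_eq_square x_inf_mult by (simp add: 1)
  have c: "2 * fls_const c = fls_const (2 * c)" for c :: complex
    by (metis fls_const_mult_const fls_const_numeral)
  show ?thesis
    unfolding conic_expr_def c 2 mult.assoc x_inf_mult by (simp add: 1)
qed

text \<open>Both roots grow linearly in $x$.\<close>

lemma conic_root_subdegree:
  assumes "A * C \<noteq> 0" "conic_expr A B C D E F x_inf y = 0"
  shows "fls_subdegree y = - 2"
proof (rule ccontr)
  define k where "k = fls_subdegree y"
  assume "fls_subdegree y \<noteq> - 2"
  have coeff0: "fls_nth (conic_expr A B C D E F x_inf y) n = 0" for n
    using assms(2) by simp
  have y0: "y \<noteq> 0"
    using coeff0[of "- 4"] assms(1) unfolding conic_expand by auto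
  have sq: "fls_nth (y ^ 2) n = 0" if "n < 2 * k" for n
    using that y0 by (intro fls_eq0_below_subdegree) (simp add: k_def fls_subdegree_pow)
  have ly: "fls_nth y n = 0" if "n < k" for n
    using that by (simp add: k_def)
  consider "k > - 2" | "k < - 2"
    using \<open>fls_subdegree y \<noteq> - 2\<close> unfolding k_def by linarith
  then show False
  proof cases
    case 1
    then show False
      using coeff0[of "- 4"] assms(1) sq[of "- 4"] ly[of "- 4"] ly[of "- 2"]
      unfolding conic_expand by simp
  next
    case 2
    have "fls_nth (y ^ 2) (2 * k) \<noteq> 0"
      using nth_fls_subdegree_nonzero[of "y ^ 2"] y0 by (simp add: k_def fls_subdegree_pow)
    then show False
      using coeff0[of "2 * k"] assms(1) ly[of "2 * k"] ly[of "2 * k + 2"] 2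
      unfolding conic_expand by simp
  qed
qed

text \<open>The two roots always exist as expansions of this kind.\<close>

lemma fls_sqrt_exists:
  fixes g :: "complex fls"
  assumes "even (fls_subdegree g)"
  shows "\<exists>s. s ^ 2 = g"
proof (cases "g = 0")
  case True
  then show ?thesis by (intro exI[of _ 0]) simp
next
  case False
  define h where "h = fls_base_factor_to_fps g"
  obtain m where m: "fls_subdegree g = 2 * m" using assms by blast
  have h0: "fps_nth h 0 \<noteq> 0" using False by (simp add: h_def)
  define q where "q = fps_radical (\<lambda>_. csqrt) (Suc 1) h"
  have "q ^ Suc 1 = h"
    unfolding q_def
  proof (subst power_radical[symmetric])
    show "csqrt (fps_nth h 0) ^ Suc 1 = fps_nth h 0"
      by (metis Suc_1 power2_csqrt)
  qed (use h0 in auto)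
  then have q: "fps_to_fls q ^ 2 = fps_to_fls h"
    by (simp add: power2_eq_square flip: fls_times_fps_to_fls)
  have "(fls_X_intpow m * fps_to_fls q) ^ 2 = fls_X_intpow (2 * m) * fps_to_fls h"
    by (simp add: power_mult_distrib q fls_X_intpow_power)
  also have "\<dots> = g"
    using fls_conv_base_factor_to_fps_shift_subdegree[of g]
    by (simp add: h_def m fls_X_intpow_times_conv_shift)
  finally show ?thesis by blast
qed

lemma conic_roots_exist:
  assumes "A \<noteq> 0"
  shows "\<exists>y1 y2. \<forall>y. conic_expr A B C D E F x_inf y = fls_const A * (y - y1) * (y - y2)"
proof -
  define a b c d e f where defs: "a = fls_const A" "b = fls_const B" "c = fls_const C"
    "d = fls_const D" "e = fls_const E" "f = fls_const F"
  define r where "r = fls_const (B ^ 2 - A * C) * fls_shift 4 1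
    + fls_const (2 * (B * D - A * E)) * fls_shift 2 1 + fls_const (D ^ 2 - A * F)"
  have a0: "a \<noteq> 0" using assms by (simp add: defs)
  have "even (fls_subdegree r)"
  proof (cases "r = 0")
    case False
    have "fls_nth r n = 0" if "odd n" for n
    proof -
      have "n + 4 \<noteq> 0" "n + 2 \<noteq> 0" "n \<noteq> 0" using that by presburger+
      then show ?thesis by (simp add: r_def)
    qed
    then show ?thesis
      using nth_fls_subdegree_nonzero[OF False] by blast
  qed simp
  then obtain s where s: "s ^ 2 = r" using fls_sqrt_exists by blast
  have x: "fls_shift 2 1 = x_inf" using x_inf_mult[of 1] by simp
  have x2: "fls_shift 4 1 = x_inf ^ 2"
    unfolding power2_eq_square x_inf_mult by (simp add: x[symmetric])
  have two: "fls_const (2 * z) = 2 * fls_const z" for z :: complex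
    by (metis fls_const_mult_const fls_const_numeral)
  have cs: "fls_const (B ^ 2 - A * C) = b ^ 2 - a * c"
    "fls_const (2 * (B * D - A * E)) = 2 * (b * d - a * e)"
    "fls_const (D ^ 2 - A * F) = d ^ 2 - a * f"
    by (simp_all only: defs two fls_minus_const fls_const_mult_const power2_eq_square)
  have s': "s ^ 2 = (b * x_inf + d) ^ 2 - a * (c * x_inf ^ 2 + 2 * e * x_inf + f)"
    unfolding s r_def x x2 cs by (simp add: power2_eq_square algebra_simps)
  have "conic_expr A B C D E F x_inf y =
      a * (y - (s - b * x_inf - d) / a) * (y - (- s - b * x_inf - d) / a)" for y
  proof -
    have div: "a * (y - z / a) = a * y - z" for z
      using a0 by (simp add: right_diff_distrib)
    have "a * (y - (s - b * x_inf - d) / a) * (y - (- s - b * x_inf - d) / a) * a =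
        (a * (y - (s - b * x_inf - d) / a)) * (a * (y - (- s - b * x_inf - d) / a))"
      by (simp only: ac_simps)
    also have "\<dots> = (a * y - (s - b * x_inf - d)) * (a * y - (- s - b * x_inf - d))"
      by (simp only: div)
    also have "\<dots> = (a * y + b * x_inf + d) ^ 2 - s ^ 2"
      by (simp add: power2_eq_square algebra_simps)
    also have "\<dots> = conic_expr A B C D E F x_inf y * a"
      unfolding s' conic_expr_def defs[symmetric] by (simp add: power2_eq_square algebra_simps)
    finally show ?thesis using a0 by (metis mult_right_cancel)
  qed
  then show ?thesis unfolding defs by blast
qed

end

theory Submission
  imports Defs
begin

text \<open>
  Write $y_1 = \varphi_1(x)$, $y_2 = \varphi_2(x)$ and $\delta = y_2 - y_1$. After multiplication by
  $2\delta$ the hypothesis for index $n$ is a linear relation, with coefficients that are polynomials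
  of bounded degree in $x$, $y_1$, $y_2$, between $p_n(y_2)$, $p_{n-1}(y_2)$, $p_n(y_1)$ and
  $p_{n-1}(y_1)$. Read it as a linear form \<open>relation_form n\<close> on pairs $(f, g)$ of solutions of the
  three-term recurrence, $f$ at the point $y_2$ and $g$ at the point $y_1$. These pairs form a
  four-dimensional space, and all the forms vanish on the pair $p = (p_n(y_2), p_n(y_1))$. The proof
  shows that all forms of large index have a common kernel of dimension two, and that the Stieltjes
  function lives in the second dimension of that kernel.

  Two of the forms are independent, so the kernel is not larger; the point is that it is not smaller.
  A relation $u\,p_{n+1}(y) + v\,p_n(y) = 0$ with $u$, $v$ of bounded degree and $n$ large is trivial
  (\<open>no_small_relation\<close>): $x$ is quadratic over the polynomials in $y$, since $C \ne 0$, and taking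
  norms gives a polynomial identity from which $p_{n+1}$, being coprime to $p_n$, would divide a
  nonzero polynomial of bounded degree. Hence three relations of bounded degree at the same large
  index are dependent (\<open>third_relation\<close>). On the other hand the explicit shape of the forms shows that
  among three successive indices there is always one whose form is independent of the next one
  (\<open>transversal_exists\<close>). So the span of the forms does not change with $n$, and whatever is killed
  by one independent consecutive pair is killed by infinitely many such pairs
  (\<open>kernel_persists_infinitely\<close>).

  Now let $q_n$ be the second polynomial solution of the recurrence, with
  $p_n S - q_n = O(y^{-n})$. In the symmetric coordinates on solution pairs that correspond to the
  operators $\mathcal D$ and $\mathcal M$, the forms have coefficients that are polynomials in $x$ alone
  (\<open>relation_form_coordinates\<close>), so a second kernel element is given by a cross product
  $(K_1, K_2, K_3)$ of polynomials in $x$ (\<open>kernel_element\<close>). Adding a multiple of the pair $p$, that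
  element becomes $f_n = e\,p_n(y_2) + O(x^{c-n})$, $g_n = O(x^{c-n})$ with a fixed $c$, where
  \[ e = \delta\,(K_3\, \mathcal D S + 2 K_2\, \mathcal M S + 2 K_1). \]
  Two independent relations of bounded degree force the growing term $e\,p_n(y_2)$ to be small as
  well, for infinitely many $n$, whence $e = 0$ (\<open>kernel_growth\<close>). This is the required equation
  for $S$.
\<close>

section \<open>Orders of series and values of polynomials\<close>

text \<open>
  The value \<open>0\<close> is admitted for every bound; its subdegree is $0$ only by convention.
\<close>

definition ord_ge :: "int \<Rightarrow> complex fls \<Rightarrow> bool" where
  "ord_ge m f \<longleftrightarrow> f = 0 \<or> m \<le> fls_subdegree f"

lemma ord_ge_mono: "ord_ge m f \<Longrightarrow> l \<le> m \<Longrightarrow> ord_ge l f"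
  by (auto simp: ord_ge_def)

lemma ord_ge_add: "ord_ge m f \<Longrightarrow> ord_ge m g \<Longrightarrow> ord_ge m (f + g)"
  unfolding ord_ge_def using fls_plus_subdegree[of f g] by force

lemma ord_ge_uminus: "ord_ge m f \<Longrightarrow> ord_ge m (- f)"
  by (simp add: ord_ge_def)

lemma ord_ge_diff: "ord_ge m f \<Longrightarrow> ord_ge m g \<Longrightarrow> ord_ge m (f - g)"
  using ord_ge_add[of m f "- g"] ord_ge_uminus[of m g] by simp

lemma ord_ge_mult: "ord_ge m f \<Longrightarrow> ord_ge l g \<Longrightarrow> ord_ge (m + l) (f * g)"
  unfolding ord_ge_def by (cases "f = 0"; cases "g = 0") auto

lemma ord_ge_const: "ord_ge 0 (fls_const c)"
  by (simp add: ord_ge_def)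

lemma poly_at_0 [simp]: "poly_at 0 y = 0"
  by (simp add: poly_at_def)

lemma poly_at_pCons: "poly_at (pCons c p) y = fls_const c + y * poly_at p y"
  by (simp add: poly_at_def map_poly_pCons)

lemma poly_at_const [simp]: "poly_at [:c:] y = fls_const c"
  by (simp add: poly_at_pCons)

lemma poly_at_1 [simp]: "poly_at 1 y = 1"
  using poly_at_const[of 1 y] by (simp only: one_pCons[symmetric] fls_const_1)

lemma poly_at_add [simp]: "poly_at (p + q) y = poly_at p y + poly_at q y"
proof (induction p q rule: poly_induct2)
  case (pCons a p b q)
  show ?case
    by (simp only: add_pCons poly_at_pCons pCons fls_plus_const[symmetric] distrib_left ac_simps)
qed simp

lemma poly_at_smult [simp]: "poly_at (smult c p) y = fls_const c * poly_at p y"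
proof (induction p)
  case (pCons a p)
  have "fls_const (c * a) = fls_const c * fls_const a"
    by (rule fls_const_mult_const[symmetric])
  with pCons show ?case
    by (simp only: smult_pCons poly_at_pCons distrib_left mult.left_commute)
qed simp

lemma poly_at_mult [simp]: "poly_at (p * q) y = poly_at p y * poly_at q y"
proof (induction p)
  case (pCons a p)
  show ?case
    by (simp add: poly_at_pCons pCons distrib_right mult.assoc)
qed simp

lemma poly_at_minus [simp]: "poly_at (- p) y = - poly_at p y"
  using poly_at_smult[of "- 1" p y] by simp

lemma poly_at_diff [simp]: "poly_at (p - q) y = poly_at p y - poly_at q y"
  by (simp only: diff_conv_add_uminus poly_at_add poly_at_minus)

lemma poly_at_subdegree:
  assumes "fls_subdegree y = - 2" "p \<noteq> 0"
  shows "poly_at p y \<noteq> 0 \<and> fls_subdegree (poly_at p y) = - 2 * int (degree p)"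
  using assms(2)
proof (induction p)
  case (pCons c p)
  show ?case
  proof (cases "p = 0")
    case True
    with pCons.prems have "c \<noteq> 0" by simp
    then show ?thesis using True by simp
  next
    case False
    have "y \<noteq> 0" using assms(1) by auto
    moreover from False pCons.IH have p: "poly_at p y \<noteq> 0"
      "fls_subdegree (poly_at p y) = - 2 * int (degree p)" by blast+
    ultimately have yp: "y * poly_at p y \<noteq> 0"
      "fls_subdegree (y * poly_at p y) = - 2 * int (degree (pCons c p))"
      using assms(1) False by (simp_all add: degree_pCons_eq)
    then have neg: "fls_subdegree (y * poly_at p y) < fls_subdegree (fls_const c)"
      using False by (simp add: degree_pCons_eq)
    from fls_subdegree_add_eq2[OF yp(1) neg]
    have d: "fls_subdegree (poly_at (pCons c p) y) = - 2 * int (degree (pCons c p))"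
      unfolding poly_at_pCons yp(2) .
    have "poly_at (pCons c p) y \<noteq> 0"
    proof
      assume "poly_at (pCons c p) y = 0"
      with d False show False by (simp add: degree_pCons_eq)
    qed
    with d show ?thesis by blast
  qed
qed simp

lemma poly_at_eq_0_iff:
  assumes "fls_subdegree y = - 2"
  shows "poly_at p y = 0 \<longleftrightarrow> p = 0"
  using poly_at_subdegree[OF assms] by auto

lemma x_inf_subdegree: "fls_subdegree x_inf = - 2"
  unfolding x_inf_def by (simp add: fls_subdegree_pow)

lemma ord_ge_poly_at:
  assumes "fls_subdegree y = - 2" "degree p \<le> k"
  shows "ord_ge (- 2 * int k) (poly_at p y)"
proof (cases "p = 0")
  case False
  from poly_at_subdegree[OF assms(1) this] assms(2) show ?thesis
    unfolding ord_ge_def by linarith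
qed (simp add: ord_ge_def)

section \<open>The roots of the conic and elements of bounded degree\<close>

locale conic =
  fixes A B C D E F :: complex and \<phi>1 \<phi>2 :: "complex fls"
  assumes AC: "A * C \<noteq> 0"
    and root1: "conic_expr A B C D E F x_inf \<phi>1 = 0"
    and root2: "conic_expr A B C D E F x_inf \<phi>2 = 0"
    and roots_neq: "\<phi>1 \<noteq> \<phi>2"
begin

lemma A0: "A \<noteq> 0" and C0: "C \<noteq> 0" using AC by auto

abbreviation X :: "complex fls" where "X \<equiv> x_inf"

text \<open>
  The two roots play symmetric roles, so what is proved about \<open>\<phi>1\<close> transfers to \<open>\<phi>2\<close>.
\<close>

lemma swap: "conic A B C D E F \<phi>2 \<phi>1"
  using AC root1 root2 roots_neq by unfold_locales auto

lemma subdegree_roots: "fls_subdegree \<phi>1 = - 2" "fls_subdegree \<phi>2 = - 2"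
  using conic_root_subdegree[OF AC] root1 root2 by auto

lemma fls_const_twice: "fls_const (2 * c) = 2 * fls_const (c :: complex)"
  by (simp add: fls_const_mult_const[symmetric] del: fls_const_mult_const)

lemma fls_const_minus_twice: "fls_const (- 2 * c) = - 2 * fls_const (c :: complex)"
  by (simp add: fls_const_mult_const[symmetric] del: fls_const_mult_const)

definition root_sum :: "complex poly" where "root_sum = [:- 2 * D / A, - 2 * B / A:]"
definition root_prod :: "complex poly" where "root_prod = [:F / A, 2 * E / A, C / A:]"

lemma const_mult_root_sum:
  "fls_const A * poly_at root_sum X = fls_const (- 2 * D) + fls_const (- 2 * B) * X"
proof -
  have "fls_const A * poly_at root_sum X
      = fls_const A * fls_const (- 2 * D / A) + fls_const A * fls_const (- 2 * B / A) * X"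
    by (simp only: root_sum_def poly_at_pCons poly_at_0 distrib_left mult_zero_left mult_zero_right add_0_right add_0_left ac_simps)
  then show ?thesis using A0 by simp
qed

lemma vieta_sum: "\<phi>1 + \<phi>2 = poly_at root_sum X"
proof -
  have "(\<phi>1 - \<phi>2) * (fls_const A * (\<phi>1 + \<phi>2) + 2 * (fls_const B * X + fls_const D)) = 0"
  proof -
    have "(\<phi>1 - \<phi>2) * (fls_const A * (\<phi>1 + \<phi>2) + 2 * (fls_const B * X + fls_const D))
      = conic_expr A B C D E F X \<phi>1 - conic_expr A B C D E F X \<phi>2"
      unfolding conic_expr_def by (simp only: power2_eq_square) algebra
    then show ?thesis unfolding root1 root2 by simp
  qed
  then have *: "fls_const A * (\<phi>1 + \<phi>2) = - 2 * (fls_const B * X + fls_const D)"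
    using roots_neq by (simp add: add_eq_0_iff)
  note const_mult_root_sum
  also have "fls_const (- 2 * D) + fls_const (- 2 * B) * X = fls_const A * (\<phi>1 + \<phi>2)"
    unfolding * fls_const_minus_twice by algebra
  finally show ?thesis using A0 by simp
qed

lemma vieta_prod: "\<phi>1 * \<phi>2 = poly_at root_prod X"
proof -
  note s = const_mult_root_sum[folded vieta_sum]
  have r: "fls_const A * \<phi>1 ^ 2 + 2 * fls_const B * X * \<phi>1 + fls_const C * X ^ 2
     + 2 * fls_const D * \<phi>1 + 2 * fls_const E * X + fls_const F = 0"
    using root1 by (simp only: conic_expr_def)
  have "fls_const A * (\<phi>1 * \<phi>2) = fls_const C * X ^ 2 + 2 * fls_const E * X + fls_const F"
    using s r unfolding fls_const_minus_twice by algebra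
  also have "\<dots> = fls_const A * fls_const (F / A) + (fls_const A * fls_const (2 * E / A)) * X + fls_const A * fls_const (C / A) * (X * X)"
    using A0 by (simp add: fls_const_twice power2_eq_square)
  also have "\<dots> = fls_const A * poly_at root_prod X"
    by (simp only: root_prod_def poly_at_pCons poly_at_0 distrib_left mult_zero_left mult_zero_right add_0_right add_0_left ac_simps)
  finally show ?thesis using A0 by simp
qed

definition \<delta> :: "complex fls" where "\<delta> = \<phi>2 - \<phi>1"

lemma \<delta>_nz: "\<delta> \<noteq> 0" using roots_neq by (simp add: \<delta>_def)

definition disc :: "complex poly" where "disc = root_sum ^ 2 - smult 4 root_prod"

lemma \<delta>_sq: "\<delta> ^ 2 = poly_at disc X"
proof -
  have "poly_at disc X = (\<phi>1 + \<phi>2) * (\<phi>1 + \<phi>2) - 4 * (\<phi>1 * \<phi>2)"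
    unfolding vieta_sum vieta_prod disc_def by (simp add: power2_eq_square)
  then show ?thesis unfolding \<delta>_def power2_eq_square by algebra
qed

text \<open>
  Differences and sums of the values at the two roots are, up to the factor $\delta$, polynomials in
  $x$: by the product rules for $\mathcal D$ and $\mathcal M$ only the elementary symmetric functions of
  the roots occur, and these are \<open>root_sum\<close> and \<open>root_prod\<close>.
\<close>

lemma symmetric_values:
  "\<exists>d m. poly_at p \<phi>2 - poly_at p \<phi>1 = \<delta> * poly_at d X \<and> poly_at p \<phi>1 + poly_at p \<phi>2 = 2 * poly_at m X"
proof (induction p)
  case 0
  show ?case by (intro exI[of _ 0]) simp
next
  case (pCons c p)
  then obtain d m where dm: "poly_at p \<phi>2 - poly_at p \<phi>1 = \<delta> * poly_at d X"
    "poly_at p \<phi>1 + poly_at p \<phi>2 = 2 * poly_at m X" by blast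
  have half: "fls_const (1/2) * (2 * u) = u" for u :: "complex fls"
    using fls_const_twice[of "1/2"] by (simp add: mult.assoc[symmetric] mult.commute)
  have 1: "2 * (\<phi>2 * poly_at p \<phi>2 - \<phi>1 * poly_at p \<phi>1) = \<delta> * (2 * poly_at m X) + (\<phi>1 + \<phi>2) * (\<delta> * poly_at d X)"
    using dm unfolding \<delta>_def by algebra
  have 2: "2 * (\<phi>1 * poly_at p \<phi>1 + \<phi>2 * poly_at p \<phi>2) = (\<phi>1 + \<phi>2) * (2 * poly_at m X) + \<delta> * (\<delta> * poly_at d X)"
    using dm unfolding \<delta>_def by algebra
  define h where "h = fls_const (1/2 :: complex)"
  have h: "2 * h = 1" unfolding h_def using fls_const_twice[of "1/2"] by simp
  show ?case
  proof (intro exI conjI)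
    show "poly_at (pCons c p) \<phi>2 - poly_at (pCons c p) \<phi>1 = \<delta> * poly_at (m + smult (1/2) (root_sum * d)) X"
      unfolding poly_at_pCons poly_at_add poly_at_smult poly_at_mult vieta_sum[symmetric] h_def[symmetric]
      using 1 h by algebra
    show "poly_at (pCons c p) \<phi>1 + poly_at (pCons c p) \<phi>2
      = 2 * poly_at ([:c:] + smult (1/2) (root_sum * m) + smult (1/2) (smult (1/2) (disc * d))) X"
      unfolding poly_at_pCons poly_at_add poly_at_smult poly_at_mult vieta_sum[symmetric] \<delta>_sq[symmetric] h_def[symmetric] poly_at_0
      using 2 h by algebra
  qed
qed

text \<open>
  Membership in the image of the polynomials of total degree at most $k$ in $x$, $y_1$, $y_2$. Using all
  three generators makes the notion symmetric in the roots and closed under products without any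
  computation in the quadratic extension.
\<close>

inductive bdeg :: "nat \<Rightarrow> complex fls \<Rightarrow> bool" where
  const: "bdeg k (fls_const c)"
| x: "bdeg k u \<Longrightarrow> bdeg (Suc k) (X * u)"
| r1: "bdeg k u \<Longrightarrow> bdeg (Suc k) (\<phi>1 * u)"
| r2: "bdeg k u \<Longrightarrow> bdeg (Suc k) (\<phi>2 * u)"
| add: "bdeg k u \<Longrightarrow> bdeg k v \<Longrightarrow> bdeg k (u + v)"

lemma bdeg_mono: "bdeg k u \<Longrightarrow> k \<le> l \<Longrightarrow> bdeg l u"
proof (induction arbitrary: l rule: bdeg.induct)
  case (x k u) then show ?case by (cases l) (auto intro: bdeg.intros)
next
  case (r1 k u) then show ?case by (cases l) (auto intro: bdeg.intros)
next
  case (r2 k u) then show ?case by (cases l) (auto intro: bdeg.intros)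
qed (auto intro: bdeg.intros)

lemma bdeg_const_mult: "bdeg k u \<Longrightarrow> bdeg k (fls_const c * u)"
proof (induction rule: bdeg.induct)
  case (const k d) then show ?case using bdeg.const[of k "c * d"] by simp
next
  case (x k u) then show ?case using bdeg.x by (simp add: mult.left_commute)
next
  case (r1 k u) then show ?case using bdeg.r1 by (simp add: mult.left_commute)
next
  case (r2 k u) then show ?case using bdeg.r2 by (simp add: mult.left_commute)
next
  case (add k u v) then show ?case using bdeg.add by (simp add: distrib_left)
qed

lemma bdeg_mult: "bdeg k u \<Longrightarrow> bdeg l v \<Longrightarrow> bdeg (k + l) (u * v)"
proof (induction rule: bdeg.induct)
  case (const k c)
  then show ?case using bdeg_mono[OF bdeg_const_mult, of l v "k + l" c] by simp
next
  case (x k u) then show ?case using bdeg.x by (simp add: mult.assoc)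
next
  case (r1 k u) then show ?case using bdeg.r1 by (simp add: mult.assoc)
next
  case (r2 k u) then show ?case using bdeg.r2 by (simp add: mult.assoc)
next
  case (add k u v) then show ?case using bdeg.add by (simp add: distrib_right)
qed

lemma bdeg_0: "bdeg k 0" using bdeg.const[of k 0] by simp
lemma bdeg_1: "bdeg k 1" using bdeg.const[of k 1] by simp
lemma bdeg_uminus: "bdeg k u \<Longrightarrow> bdeg k (- u)"
  using bdeg_const_mult[of k u "- 1"] by simp
lemma bdeg_diff: "bdeg k u \<Longrightarrow> bdeg k v \<Longrightarrow> bdeg k (u - v)"
  using bdeg.add[of k u "- v"] bdeg_uminus[of k v] by simp

lemma bdeg_roots: "bdeg 1 \<phi>1" "bdeg 1 \<phi>2" "bdeg 1 \<delta>"
proof -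
  show "bdeg 1 \<phi>1" "bdeg 1 \<phi>2"
    using bdeg.r1[OF bdeg_1[of 0]] bdeg.r2[OF bdeg_1[of 0]] by simp_all
  then show "bdeg 1 \<delta>" unfolding \<delta>_def by (intro bdeg_diff)
qed

lemma bdeg_poly_X: "degree p \<le> k \<Longrightarrow> bdeg k (poly_at p X)"
proof (induction p arbitrary: k)
  case (pCons c p)
  show ?case
  proof (cases "p = 0")
    case False
    with pCons obtain l where "k = Suc l" "degree p \<le> l" by (cases k) auto
    with pCons.IH[of l] show ?thesis
      unfolding poly_at_pCons by (auto intro: bdeg.intros)
  qed (auto intro: bdeg.intros)
qed (simp add: bdeg_0)

lemma bdeg_swap_imp: "bdeg k u \<Longrightarrow> conic.bdeg \<phi>2 \<phi>1 k u"
proof (induction rule: bdeg.induct)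
qed (auto intro: conic.bdeg.intros[OF swap])

lemma ord_ge_bdeg: "bdeg k u \<Longrightarrow> ord_ge (- 2 * int k) u"
proof (induction rule: bdeg.induct)
  case (const k c) then show ?case using ord_ge_mono[OF ord_ge_const] by simp
next
  case (x k u)
  then show ?case using ord_ge_mult[of "-2" X] x_inf_subdegree by (force simp: ord_ge_def)
next
  case (r1 k u)
  then show ?case using ord_ge_mult[of "-2" \<phi>1] subdegree_roots by (force simp: ord_ge_def)
next
  case (r2 k u)
  then show ?case using ord_ge_mult[of "-2" \<phi>2] subdegree_roots by (force simp: ord_ge_def)
next
  case (add k u v)
  then show ?case by (intro ord_ge_add)
qed

section \<open>Norms\<close>

text \<open>
  As $C \ne 0$, the conic is also a quadratic equation for $x$ over the polynomials in $y_1$. Its other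
  root \<open>x_conj\<close> serves as a conjugate of $x$, and \<open>norm_poly\<close> as the corresponding norm form. When
  $x$ is itself a polynomial in $y_1$ (degenerate conics), conjugation is not a function on the series,
  so norms are formed from chosen coefficients and a vanishing conjugate is a case of its own below.
\<close>

definition x_sum :: "complex poly" where "x_sum = [:- 2 * E / C, - 2 * B / C:]"
definition x_prod :: "complex poly" where "x_prod = [:F / C, 2 * D / C, A / C:]"
definition x_conj :: "complex fls" where "x_conj = poly_at x_sum \<phi>1 - X"
definition norm_poly :: "complex poly \<Rightarrow> complex poly \<Rightarrow> complex poly" where
  "norm_poly a0 a1 = a0 * a0 + a0 * a1 * x_sum + a1 * a1 * x_prod"

lemma x_mult_conj: "X * x_conj = poly_at x_prod \<phi>1"
proof -
  have s: "fls_const C * poly_at x_sum \<phi>1 = fls_const (- 2 * E) + fls_const (- 2 * B) * \<phi>1"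
  proof -
    have "fls_const C * poly_at x_sum \<phi>1
        = fls_const C * fls_const (- 2 * E / C) + fls_const C * fls_const (- 2 * B / C) * \<phi>1"
      by (simp only: x_sum_def poly_at_pCons poly_at_0 distrib_left mult_zero_left mult_zero_right add_0_right add_0_left ac_simps)
    then show ?thesis using C0 by simp
  qed
  have p: "fls_const C * poly_at x_prod \<phi>1 = fls_const F + fls_const (2 * D) * \<phi>1 + fls_const A * (\<phi>1 * \<phi>1)"
  proof -
    have "fls_const C * poly_at x_prod \<phi>1
        = fls_const C * fls_const (F / C) + fls_const C * fls_const (2 * D / C) * \<phi>1 + fls_const C * fls_const (A / C) * (\<phi>1 * \<phi>1)"
      by (simp only: x_prod_def poly_at_pCons poly_at_0 distrib_left mult_zero_left mult_zero_right add_0_right add_0_left ac_simps)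
    then show ?thesis using C0 by simp
  qed
  have r: "fls_const A * \<phi>1 ^ 2 + 2 * fls_const B * X * \<phi>1 + fls_const C * X ^ 2
     + 2 * fls_const D * \<phi>1 + 2 * fls_const E * X + fls_const F = 0"
    using root1 by (simp only: conic_expr_def)
  have "fls_const C * (X * x_conj) = fls_const C * poly_at x_prod \<phi>1"
    using s r unfolding x_conj_def p fls_const_minus_twice fls_const_twice by algebra
  then show ?thesis using C0 by simp
qed

lemma x_add_conj: "X + x_conj = poly_at x_sum \<phi>1"
  by (simp add: x_conj_def)

lemma norm_poly: "(poly_at a0 \<phi>1 + poly_at a1 \<phi>1 * X) * (poly_at a0 \<phi>1 + poly_at a1 \<phi>1 * x_conj)
   = poly_at (norm_poly a0 a1) \<phi>1"
  unfolding norm_poly_def poly_at_add poly_at_mult x_mult_conj[symmetric] x_add_conj[symmetric]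
  by algebra

lemma degree_norm_poly:
  assumes "degree a0 \<le> m" "degree a1 \<le> m"
  shows "degree (norm_poly a0 a1) \<le> 2 * m + 2"
proof -
  have s: "degree x_sum \<le> 1" "degree x_prod \<le> 2"
    by (auto simp: x_sum_def x_prod_def)
  have "degree (a0 * a0) \<le> 2 * m + 2" "degree (a0 * a1 * x_sum) \<le> 2 * m + 2" "degree (a1 * a1 * x_prod) \<le> 2 * m + 2"
    using degree_mult_le[of a0 a0] degree_mult_le[of "a0 * a1" x_sum] degree_mult_le[of a0 a1]
      degree_mult_le[of "a1 * a1" x_prod] degree_mult_le[of a1 a1] s assms by linarith+
  then show ?thesis unfolding norm_poly_def by (intro degree_add_le)
qed

lemma bdeg_normal_form:
  "bdeg k u \<Longrightarrow> \<exists>a0 a1. degree a0 \<le> 2 * k \<and> degree a1 \<le> 2 * k \<and> u = poly_at a0 \<phi>1 + poly_at a1 \<phi>1 * X"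
proof (induction rule: bdeg.induct)
  case (const k c)
  show ?case by (rule exI[of _ "[:c:]"], rule exI[of _ 0]) simp
next
  have mul_x: "\<exists>a0 a1. degree a0 \<le> 2 * k + 2 \<and> degree a1 \<le> 2 * k + 2 \<and>
      X * u = poly_at a0 \<phi>1 + poly_at a1 \<phi>1 * X"
    if a: "degree a0 \<le> 2 * k" "degree a1 \<le> 2 * k" and u: "u = poly_at a0 \<phi>1 + poly_at a1 \<phi>1 * X" for a0 a1 k u
  proof (intro exI conjI)
    have s: "degree x_sum \<le> 1" "degree x_prod \<le> 2"
      by (auto simp: x_sum_def x_prod_def)
    show "degree (- (a1 * x_prod)) \<le> 2 * k + 2"
      using degree_mult_le[of a1 x_prod] s a by simp
    show "degree (a0 + a1 * x_sum) \<le> 2 * k + 2"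
      using degree_mult_le[of a1 x_sum] s a by (intro degree_add_le) simp_all
    have "X * X = poly_at x_sum \<phi>1 * X - poly_at x_prod \<phi>1"
      unfolding x_mult_conj[symmetric] x_add_conj[symmetric] by algebra
    then show "X * u = poly_at (- (a1 * x_prod)) \<phi>1 + poly_at (a0 + a1 * x_sum) \<phi>1 * X"
      unfolding u poly_at_add poly_at_minus poly_at_mult by algebra
  qed
  have mul_r1: "\<exists>a0 a1. degree a0 \<le> 2 * k + 2 \<and> degree a1 \<le> 2 * k + 2 \<and>
      \<phi>1 * u = poly_at a0 \<phi>1 + poly_at a1 \<phi>1 * X"
    if a: "degree a0 \<le> 2 * k" "degree a1 \<le> 2 * k" and u: "u = poly_at a0 \<phi>1 + poly_at a1 \<phi>1 * X" for a0 a1 k u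
  proof (intro exI conjI)
    show "degree (pCons 0 a0) \<le> 2 * k + 2" "degree (pCons 0 a1) \<le> 2 * k + 2"
      using a degree_pCons_le[of 0 a0] degree_pCons_le[of 0 a1] by linarith+
    show "\<phi>1 * u = poly_at (pCons 0 a0) \<phi>1 + poly_at (pCons 0 a1) \<phi>1 * X"
      unfolding u poly_at_pCons by (simp add: algebra_simps)
  qed
  {
    case (x k u) then show ?case using mul_x by fastforce
  next
    case (r1 k u) then show ?case using mul_r1 by fastforce
  next
    case (r2 k u)
    then obtain a0 a1 where a: "degree a0 \<le> 2 * k" "degree a1 \<le> 2 * k" "u = poly_at a0 \<phi>1 + poly_at a1 \<phi>1 * X"
      by blast
    obtain c0 c1 where c: "degree c0 \<le> 2 * k + 2" "degree c1 \<le> 2 * k + 2" "X * u = poly_at c0 \<phi>1 + poly_at c1 \<phi>1 * X"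
      using mul_x[OF a] by blast
    obtain d0 d1 where d: "degree d0 \<le> 2 * k + 2" "degree d1 \<le> 2 * k + 2" "\<phi>1 * u = poly_at d0 \<phi>1 + poly_at d1 \<phi>1 * X"
      using mul_r1[OF a] by blast
    obtain s0 s1 where s: "root_sum = [:s0, s1:]" unfolding root_sum_def by blast
    have "\<phi>2 = fls_const s0 + fls_const s1 * X - \<phi>1"
      using vieta_sum unfolding s poly_at_pCons poly_at_0 by algebra
    then have "\<phi>2 * u = fls_const s0 * u + fls_const s1 * (X * u) - \<phi>1 * u"
      by algebra
    also have "\<dots> = poly_at (smult s0 a0 + smult s1 c0 - d0) \<phi>1 + poly_at (smult s0 a1 + smult s1 c1 - d1) \<phi>1 * X"
      unfolding c(3) d(3) unfolding a(3) poly_at_add poly_at_diff poly_at_smult by algebra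
    finally have e: "\<phi>2 * u = \<dots>" .
    have "degree (smult s0 a0 + smult s1 c0 - d0) \<le> 2 * Suc k" "degree (smult s0 a1 + smult s1 c1 - d1) \<le> 2 * Suc k"
      using a(1,2) c(1,2) d(1,2) by (auto intro!: degree_add_le degree_diff_le order.trans[OF degree_smult_le])
    with e show ?case by blast
  next
    case (add k u v)
    then obtain a0 a1 b0 b1 where a: "degree a0 \<le> 2 * k" "degree a1 \<le> 2 * k" "u = poly_at a0 \<phi>1 + poly_at a1 \<phi>1 * X"
     and b: "degree b0 \<le> 2 * k" "degree b1 \<le> 2 * k" "v = poly_at b0 \<phi>1 + poly_at b1 \<phi>1 * X"
      by blast
    have "u + v = poly_at (a0 + b0) \<phi>1 + poly_at (a1 + b1) \<phi>1 * X"
      unfolding a(3) b(3) by (simp add: algebra_simps)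
    with a(1,2) b(1,2) show ?case by (blast intro: degree_add_le)
  }
qed

text \<open>
  An element of bounded degree cannot be arbitrarily small at infinity. If its conjugate is nonzero, the
  product is a nonzero polynomial in $y_1$, hence not small, while the conjugate is not large. If its
  conjugate vanishes, the element is a polynomial multiple of the fixed series $x - \bar x$.
\<close>

lemma bdeg_subdegree_bounded: "\<exists>M. \<forall>u. bdeg k u \<longrightarrow> u \<noteq> 0 \<longrightarrow> fls_subdegree u \<le> M"
proof (intro exI allI impI)
  fix u assume u: "bdeg k u" "u \<noteq> 0"
  obtain a0 a1 where a: "degree a0 \<le> 2 * k" "degree a1 \<le> 2 * k" "u = poly_at a0 \<phi>1 + poly_at a1 \<phi>1 * X"
    using bdeg_normal_form[OF u(1)] by blast
  define v where "v = poly_at a0 \<phi>1 + poly_at a1 \<phi>1 * x_conj"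
  note sub = subdegree_roots(1)
  have uv: "u * v = poly_at (norm_poly a0 a1) \<phi>1" unfolding a v_def by (rule norm_poly)
  show "fls_subdegree u \<le> max (4 * int k + 2) (fls_subdegree (X - x_conj))"
  proof (cases "v = 0")
    case True
    have "u = poly_at a1 \<phi>1 * (X - x_conj)" using True unfolding v_def a by algebra
    moreover from this u have "poly_at a1 \<phi>1 \<noteq> 0" "X - x_conj \<noteq> 0" by auto
    moreover from this have "a1 \<noteq> 0" by auto
    ultimately show ?thesis using poly_at_subdegree[OF sub, of a1] by simp
  next
    case False
    have "ord_ge (- 2) x_conj" unfolding x_conj_def
      using ord_ge_poly_at[OF sub, of x_sum 1] x_inf_subdegree
      by (intro ord_ge_diff) (auto simp: x_sum_def ord_ge_def)
    then have "ord_ge (- 2 * int (2 * k) + - 2) v" unfolding v_def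
      using a(1,2) ord_ge_mono[OF ord_ge_poly_at[OF sub a(1)]]
      by (intro ord_ge_add ord_ge_mult ord_ge_poly_at[OF sub]) auto
    then have "- 4 * int k - 2 \<le> fls_subdegree v" using False by (simp add: ord_ge_def)
    moreover have "norm_poly a0 a1 \<noteq> 0" using uv u False by auto
    then have "fls_subdegree (u * v) \<le> 0" using poly_at_subdegree[OF sub] unfolding uv by simp
    ultimately show ?thesis using u False by simp
  qed
qed

lemma bezout_dvd:
  assumes "G * P + H * Q = (1 :: complex poly)" "P dvd Q * M" shows "P dvd M"
proof -
  have "M = P * (G * M) + H * (Q * M)" using assms(1) by algebra
  moreover have "P dvd P * (G * M) + H * (Q * M)"
    using assms(2) by (intro dvd_add) simp_all
  ultimately show ?thesis by simp
qed

lemma low_degree_dvd: "P dvd M \<Longrightarrow> degree M < degree P \<Longrightarrow> M = (0 :: complex poly)"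
  using dvd_imp_degree_le by fastforce

text \<open>
  Multiplying the relation by its conjugate gives
  $N(u) P^2 + T P Q + N(v) Q^2 = 0$ with polynomials in $y_1$ as coefficients. Coprimality makes $P$
  divide $N(v)$ and $Q$ divide $N(u)$, and the degree bounds make both norms zero. The remaining
  possibility that both conjugates vanish leaves a relation with polynomial coefficients, to which the
  divisibility argument applies directly.
\<close>

lemma no_small_relation1:
  assumes bez: "G * P + H * Q = 1" and deg: "degree P > 4 * k + 2" "degree Q > 4 * k + 2"
    and bdeg: "bdeg k u" "bdeg k v" and rel: "u * poly_at P \<phi>1 + v * poly_at Q \<phi>1 = 0"
  shows "u = 0 \<and> v = 0"
proof -
  note sub = subdegree_roots(1)
  have PQ: "poly_at P \<phi>1 \<noteq> 0" "poly_at Q \<phi>1 \<noteq> 0"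
    using deg by (auto simp: poly_at_eq_0_iff[OF sub])
  have bez': "H * Q + G * P = 1" using bez by (simp add: add.commute)
  obtain a0 a1 where a: "degree a0 \<le> 2 * k" "degree a1 \<le> 2 * k" "u = poly_at a0 \<phi>1 + poly_at a1 \<phi>1 * X"
    using bdeg_normal_form[OF bdeg(1)] by blast
  obtain b0 b1 where b: "degree b0 \<le> 2 * k" "degree b1 \<le> 2 * k" "v = poly_at b0 \<phi>1 + poly_at b1 \<phi>1 * X"
    using bdeg_normal_form[OF bdeg(2)] by blast
  define u' v' where u': "u' = poly_at a0 \<phi>1 + poly_at a1 \<phi>1 * x_conj"
    and v': "v' = poly_at b0 \<phi>1 + poly_at b1 \<phi>1 * x_conj"
  have uu: "u * u' = poly_at (norm_poly a0 a1) \<phi>1" unfolding a u' by (rule norm_poly)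
  have vv: "v * v' = poly_at (norm_poly b0 b1) \<phi>1" unfolding b v' by (rule norm_poly)
  define T where "T = 2 * a0 * b0 + (a0 * b1 + a1 * b0) * x_sum + 2 * a1 * b1 * x_prod"
  have two: "poly_at 2 \<phi>1 = 2" by (metis one_add_one poly_at_1 poly_at_add)
  have T: "u * v' + u' * v = poly_at T \<phi>1"
    unfolding T_def a b u' v' poly_at_add poly_at_mult two x_mult_conj[symmetric] x_add_conj[symmetric]
    by algebra
  have "poly_at (norm_poly a0 a1 * P * P + P * Q * T + norm_poly b0 b1 * Q * Q) \<phi>1 = 0"
    using rel unfolding poly_at_add poly_at_mult uu[symmetric] vv[symmetric] T[symmetric] by algebra
  then have eq: "norm_poly a0 a1 * P * P + P * Q * T + norm_poly b0 b1 * Q * Q = 0"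
    by (simp only: poly_at_eq_0_iff[OF sub])
  have degn: "degree (norm_poly a0 a1) \<le> 4 * k + 2" "degree (norm_poly b0 b1) \<le> 4 * k + 2"
    using degree_norm_poly[OF a(1,2)] degree_norm_poly[OF b(1,2)] by simp_all
  have "Q * (Q * norm_poly b0 b1) = P * (- (norm_poly a0 a1 * P + Q * T))"
    using eq by algebra
  then have "P dvd Q * (Q * norm_poly b0 b1)" by simp
  then have "P dvd norm_poly b0 b1" using bezout_dvd[OF bez] by blast
  moreover have "degree (norm_poly b0 b1) < degree P" using degn deg by linarith
  ultimately have "norm_poly b0 b1 = 0" by (rule low_degree_dvd)
  then have vv0: "v * v' = 0" using vv by simp
  have "P * (P * norm_poly a0 a1) = Q * (- (norm_poly b0 b1 * Q + P * T))"
    using eq by algebra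
  then have "Q dvd P * (P * norm_poly a0 a1)" by simp
  then have "Q dvd norm_poly a0 a1" using bezout_dvd[OF bez'] by blast
  moreover have "degree (norm_poly a0 a1) < degree Q" using degn deg by linarith
  ultimately have "norm_poly a0 a1 = 0" by (rule low_degree_dvd)
  then have uu0: "u * u' = 0" using uu by simp
  show ?thesis
  proof (rule ccontr)
    assume "\<not> (u = 0 \<and> v = 0)"
    with rel PQ have nz: "u \<noteq> 0" "v \<noteq> 0" by auto
    with uu0 vv0 have z: "u' = 0" "v' = 0" by auto
    have fac: "u = poly_at a1 \<phi>1 * (X - x_conj)" "v = poly_at b1 \<phi>1 * (X - x_conj)"
      using z unfolding u' v' a b by algebra+
    with nz have "X - x_conj \<noteq> 0" by auto
    moreover have "poly_at (a1 * P + b1 * Q) \<phi>1 * (X - x_conj) = 0"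
      using rel unfolding fac poly_at_add poly_at_mult by algebra
    ultimately have "poly_at (a1 * P + b1 * Q) \<phi>1 = 0" by (metis mult_eq_0_iff)
    then have "a1 * P + b1 * Q = 0" by (simp only: poly_at_eq_0_iff[OF sub])
    then have "Q * b1 = P * (- a1)" by algebra
    then have "P dvd Q * b1" by simp
    then have "P dvd b1" by (rule bezout_dvd[OF bez])
    moreover have "degree b1 < degree P" using b(2) deg by linarith
    ultimately have "b1 = 0" by (rule low_degree_dvd)
    with fac nz show False by simp
  qed
qed

lemma no_small_relation2:
  assumes bez: "G * P + H * Q = 1" and deg: "degree P > 4 * k + 2" "degree Q > 4 * k + 2"
    and bdeg: "bdeg k u" "bdeg k v" and rel: "u * poly_at P \<phi>2 + v * poly_at Q \<phi>2 = 0"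
  shows "u = 0 \<and> v = 0"
  using conic.no_small_relation1[OF swap bez deg bdeg_swap_imp[OF bdeg(1)] bdeg_swap_imp[OF bdeg(2)] rel] .

end

section \<open>The relations as linear forms on solution pairs\<close>

text \<open>
  The orthogonality of \<open>P\<close> is encoded by the smallness of $P_n S - Q_n$ at both roots, where
  \<open>Q\<close> is an independent second solution of the recurrence. The relation is the one of the theorem,
  multiplied by $2\delta$.
\<close>

locale first_order_relation = conic +
  fixes a b :: "nat \<Rightarrow> complex" and P Q :: "nat \<Rightarrow> complex poly"
    and S1 S2 :: "complex fls" and W \<Omega> \<Theta> :: "nat \<Rightarrow> complex poly" and d :: nat
  assumes a_nz: "n \<ge> 1 \<Longrightarrow> a n \<noteq> 0"
    and degree_P: "degree (P n) = n" and P0: "P 0 \<noteq> 0"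
    and rec_P: "n \<ge> 1 \<Longrightarrow> smult (a (Suc n)) (P (Suc n)) = [:- b n, 1:] * P n - smult (a n) (P (n - 1))"
    and rec_Q: "n \<ge> 1 \<Longrightarrow> smult (a (Suc n)) (Q (Suc n)) = [:- b n, 1:] * Q n - smult (a n) (Q (n - 1))"
    and casoratian_0: "\<exists>\<kappa>. \<kappa> \<noteq> 0 \<and> P 0 * Q 1 - P 1 * Q 0 = [:\<kappa>:]"
    and remainder1: "ord_ge (2 * int n) (poly_at (P n) \<phi>1 * S1 - poly_at (Q n) \<phi>1)"
    and remainder2: "ord_ge (2 * int n) (poly_at (P n) \<phi>2 * S2 - poly_at (Q n) \<phi>2)"
    and nontrivial: "n \<ge> 1 \<Longrightarrow> \<not> (W n = 0 \<and> \<Omega> n = 0 \<and> \<Theta> n = 0)"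
    and degrees: "n \<ge> 1 \<Longrightarrow> degree (W n) \<le> d \<and> degree (\<Omega> n) \<le> d \<and> degree (\<Theta> n) \<le> d"
    and relation: "n \<ge> 1 \<Longrightarrow>
      2 * poly_at (W n) X * (poly_at (P n) \<phi>2 - poly_at (P n) \<phi>1)
      - \<delta> * poly_at (\<Omega> n) X * (poly_at (P n) \<phi>2 + poly_at (P n) \<phi>1)
      + fls_const (a n) * \<delta> * poly_at (\<Theta> n) X * (poly_at (P (n - 1)) \<phi>2 + poly_at (P (n - 1)) \<phi>1) = 0"
begin

text \<open>
  The recurrence starts at $n = 1$, so that a solution is determined by two arbitrary successive values
  and the polynomials of the second kind are solutions too.
\<close>

definition solves :: "complex fls \<Rightarrow> (nat \<Rightarrow> complex fls) \<Rightarrow> bool" where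
  "solves y f \<longleftrightarrow> (\<forall>n\<ge>1. fls_const (a (Suc n)) * f (Suc n) = (y - fls_const (b n)) * f n - fls_const (a n) * f (n - 1))"

lemma solves_combination:
  assumes "solves y f" "solves y g" shows "solves y (\<lambda>n. u * f n + v * g n)"
  unfolding solves_def
proof (intro allI impI)
  fix n :: nat assume n: "n \<ge> 1"
  have 1: "fls_const (a (Suc n)) * f (Suc n) = (y - fls_const (b n)) * f n - fls_const (a n) * f (n - 1)"
    "fls_const (a (Suc n)) * g (Suc n) = (y - fls_const (b n)) * g n - fls_const (a n) * g (n - 1)"
    using assms n unfolding solves_def by auto
  show "fls_const (a (Suc n)) * (u * f (Suc n) + v * g (Suc n)) =
    (y - fls_const (b n)) * (u * f n + v * g n) - fls_const (a n) * (u * f (n - 1) + v * g (n - 1))"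
    using 1 by algebra
qed

lemma solves_poly:
  assumes "\<And>n. n \<ge> 1 \<Longrightarrow> smult (a (Suc n)) (R (Suc n)) = [:- b n, 1:] * R n - smult (a n) (R (n - 1))"
  shows "solves y (\<lambda>n. poly_at (R n) y)"
  unfolding solves_def
proof (intro allI impI)
  fix n :: nat assume n: "n \<ge> 1"
  have "fls_const (a (Suc n)) * poly_at (R (Suc n)) y = poly_at (smult (a (Suc n)) (R (Suc n))) y" by simp
  also have "\<dots> = (y - fls_const (b n)) * poly_at (R n) y - fls_const (a n) * poly_at (R (n - 1)) y"
  proof -
    have "poly_at [:- b n, 1:] y = y - fls_const (b n)"
      using poly_at_minus[of "[:b n:]" y] by (simp add: poly_at_pCons)
    then show ?thesis unfolding assms[OF n] poly_at_diff poly_at_mult poly_at_smult by simp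
  qed
  finally show "fls_const (a (Suc n)) * poly_at (R (Suc n)) y = (y - fls_const (b n)) * poly_at (R n) y - fls_const (a n) * poly_at (R (n - 1)) y" .
qed

lemmas solves_P = solves_poly[of P, OF rec_P]
lemmas solves_Q = solves_poly[of Q, OF rec_Q]

lemma solves_0: "solves y (\<lambda>_. 0)" by (simp add: solves_def)

text \<open>
  The Casoratian is a nonzero constant, which is at once the independence of the two solutions and a
  Bezout identity for $P_n$ and $P_{n+1}$.
\<close>

lemma casoratian: "\<exists>\<kappa>. \<kappa> \<noteq> 0 \<and> P n * Q (Suc n) - P (Suc n) * Q n = [:\<kappa>:]"
proof (induction n)
  case (Suc n)
  then obtain \<kappa> where k: "\<kappa> \<noteq> 0" "P n * Q (Suc n) - P (Suc n) * Q n = [:\<kappa>:]" by blast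
  define \<alpha> \<beta> where "\<alpha> = [:a (Suc (Suc n)):]" and "\<beta> = [:a (Suc n):]"
  have r: "\<alpha> * P (Suc (Suc n)) = [:- b (Suc n), 1:] * P (Suc n) - \<beta> * P n"
    "\<alpha> * Q (Suc (Suc n)) = [:- b (Suc n), 1:] * Q (Suc n) - \<beta> * Q n"
    using rec_P[of "Suc n"] rec_Q[of "Suc n"] by (simp_all add: \<alpha>_def \<beta>_def)
  have "\<alpha> * (P (Suc n) * Q (Suc (Suc n)) - P (Suc (Suc n)) * Q (Suc n)) = \<beta> * (P n * Q (Suc n) - P (Suc n) * Q n)"
    using r by algebra
  also have "\<dots> = [:a (Suc n) * \<kappa>:]" unfolding k(2) \<beta>_def by (simp add: mult.commute)
  finally have "smult (1 / a (Suc (Suc n))) (smult (a (Suc (Suc n))) (P (Suc n) * Q (Suc (Suc n)) - P (Suc (Suc n)) * Q (Suc n)))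
    = smult (1 / a (Suc (Suc n))) [:a (Suc n) * \<kappa>:]" by (simp add: \<alpha>_def)
  then have "P (Suc n) * Q (Suc (Suc n)) - P (Suc (Suc n)) * Q (Suc n) = [:a (Suc n) * \<kappa> / a (Suc (Suc n)):]"
    using a_nz[of "Suc (Suc n)"] by simp
  then show ?case using k(1) a_nz[of "Suc n"] a_nz[of "Suc (Suc n)"] by force
qed (use casoratian_0 in simp)

lemma P_nz: "P n \<noteq> 0"
  using P0 degree_P[of n] by (cases n) auto

lemma no_small_relation:
  assumes "n > 4 * k + 2" "bdeg k u" "bdeg k v" "y = \<phi>1 \<or> y = \<phi>2"
    and rel: "u * poly_at (P (Suc n)) y + v * poly_at (P n) y = 0"
  shows "u = 0 \<and> v = 0"
proof -
  obtain \<kappa> where k: "\<kappa> \<noteq> 0" "P n * Q (Suc n) - P (Suc n) * Q n = [:\<kappa>:]" using casoratian by blast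
  have "smult (- 1 / \<kappa>) (Q n) * P (Suc n) + smult (1 / \<kappa>) (Q (Suc n)) * P n
    = smult (1 / \<kappa>) (P n * Q (Suc n) - P (Suc n) * Q n)" 
    by (simp add: smult_diff_right mult.commute)
  also have "\<dots> = 1" unfolding k(2) using k(1) by (simp add: one_pCons)
  finally have bez: "smult (- 1 / \<kappa>) (Q n) * P (Suc n) + smult (1 / \<kappa>) (Q (Suc n)) * P n = 1" .
  have deg: "degree (P (Suc n)) > 4 * k + 2" "degree (P n) > 4 * k + 2"
    using assms(1) degree_P by auto
  from assms(4) show ?thesis
    using no_small_relation1[OF bez deg assms(2,3)] no_small_relation2[OF bez deg assms(2,3)] rel by blast
qed

definition relation_form :: "nat \<Rightarrow> (nat \<Rightarrow> complex fls) \<Rightarrow> (nat \<Rightarrow> complex fls) \<Rightarrow> complex fls" where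
  "relation_form n f g = 2 * poly_at (W n) X * (f n - g n) - \<delta> * poly_at (\<Omega> n) X * (f n + g n)
     + fls_const (a n) * \<delta> * poly_at (\<Theta> n) X * (f (n - 1) + g (n - 1))"

lemma relation_form_P: "n \<ge> 1 \<Longrightarrow> relation_form n (\<lambda>n. poly_at (P n) \<phi>2) (\<lambda>n. poly_at (P n) \<phi>1) = 0"
  unfolding relation_form_def using relation by simp

text \<open>
  On solution pairs, a form that involves other indices can be expressed through the values at
  $n + 1$ and $n$. Moving the base index down by one costs one in the degree of the coefficients
  (\<open>represents_down\<close>), so forms of nearby indices can be compared over a common base with a uniform
  degree bound.
\<close>

definition represents where
  "represents n k l c1 c2 c3 c4 \<longleftrightarrow> bdeg k c1 \<and> bdeg k c2 \<and> bdeg k c3 \<and> bdeg k c4 \<and>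
    (\<forall>f g. solves \<phi>2 f \<longrightarrow> solves \<phi>1 g \<longrightarrow>
      l f g = c1 * f (Suc n) + c2 * f n + c3 * g (Suc n) + c4 * g n)"

lemma represents_mono:
  assumes "represents n k l c1 c2 c3 c4" "k \<le> k'" shows "represents n k' l c1 c2 c3 c4"
  using assms bdeg_mono unfolding represents_def by blast

lemma represents_down:
  assumes "represents (Suc n) k l c1 c2 c3 c4"
  shows "\<exists>c1 c2 c3 c4. represents n (Suc k) l c1 c2 c3 c4"
proof -
  define r s t where "r = fls_const (1 / a (Suc (Suc n)))" and "s = fls_const (b (Suc n))" 
    and "t = fls_const (a (Suc n))"
  have step: "f (Suc (Suc n)) = r * ((y - s) * f (Suc n) - t * f n)" if "solves y f" for y f
  proof -
    have "fls_const (a (Suc (Suc n))) * f (Suc (Suc n)) = (y - s) * f (Suc n) - t * f n"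
      using that unfolding solves_def s_def t_def by fastforce
    moreover have "r * fls_const (a (Suc (Suc n))) = 1"
      using a_nz[of "Suc (Suc n)"] by (simp add: r_def)
    ultimately show ?thesis by (metis mult.assoc mult_1_left)
  qed
  have rs: "bdeg 0 r" "bdeg 0 t" "bdeg 0 s" unfolding r_def s_def t_def by (rule bdeg.const)+
  have root: "bdeg (Suc k) (r * c * (y - s))" if "bdeg k c" "bdeg 1 y" for c y
    using bdeg_mult[OF bdeg_mult[OF rs(1) that(1)] bdeg_diff[OF that(2) bdeg_mono[OF rs(3)]]] by simp
  have cst: "bdeg (Suc k) (- (r * t * c))" if "bdeg k c" for c
    using bdeg_uminus[OF bdeg_mono[OF bdeg_mult[OF bdeg_mult[OF rs(1,2)] that]]] by simp
  have "represents n (Suc k) l (r * c1 * (\<phi>2 - s) + c2) (- (r * t * c1)) (r * c3 * (\<phi>1 - s) + c4) (- (r * t * c3))"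
    unfolding represents_def
  proof (intro conjI allI impI)
    fix f g assume fg: "solves \<phi>2 f" "solves \<phi>1 g"
    with assms have "l f g = c1 * f (Suc (Suc n)) + c2 * f (Suc n) + c3 * g (Suc (Suc n)) + c4 * g (Suc n)"
      unfolding represents_def by blast
    then show "l f g = (r * c1 * (\<phi>2 - s) + c2) * f (Suc n) + (- (r * t * c1)) * f n +
       (r * c3 * (\<phi>1 - s) + c4) * g (Suc n) + (- (r * t * c3)) * g n"
      unfolding step[OF fg(1)] step[OF fg(2)] by algebra
  qed (use assms bdeg_roots root cst bdeg_mono[of k _ "Suc k"] in \<open>auto simp: represents_def intro!: bdeg.add\<close>)
  then show ?thesis by blast
qed

text \<open>
  The coefficients, at the base index $n$, of the form of index $n + 1$ are $h_1, h_2, h_3, h_2$ taken at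
  $n + 1$, and those of the form of index $n$ are $l_1, l_2, l_1, l_4$ taken at $n$. The equal entries in
  second and fourth, respectively first and third position, are what limits the dependence of
  consecutive forms.
\<close>

definition "h1 n = 2 * poly_at (W n) X - \<delta> * poly_at (\<Omega> n) X"
definition "h2 n = fls_const (a n) * \<delta> * poly_at (\<Theta> n) X"
definition "h3 n = - 2 * poly_at (W n) X - \<delta> * poly_at (\<Omega> n) X"
definition "l1 n = - fls_const (a (Suc n)) * \<delta> * poly_at (\<Theta> n) X"
definition "l2 n = 2 * poly_at (W n) X - \<delta> * poly_at (\<Omega> n) X + \<delta> * poly_at (\<Theta> n) X * (\<phi>2 - fls_const (b n))"
definition "l4 n = - 2 * poly_at (W n) X - \<delta> * poly_at (\<Omega> n) X + \<delta> * poly_at (\<Theta> n) X * (\<phi>1 - fls_const (b n))"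

lemma bdeg_coeffs:
  assumes "n \<ge> 1"
  shows "bdeg (Suc d) (h1 n)" "bdeg (Suc d) (h2 n)" "bdeg (Suc d) (h3 n)"
    "bdeg (Suc (Suc d)) (l1 n)" "bdeg (Suc (Suc d)) (l2 n)" "bdeg (Suc (Suc d)) (l4 n)"
proof -
  have p: "bdeg d (poly_at (W n) X)" "bdeg d (poly_at (\<Omega> n) X)" "bdeg d (poly_at (\<Theta> n) X)"
    using degrees[OF assms] by (auto intro: bdeg_poly_X)
  have dp: "bdeg (Suc d) (\<delta> * poly_at (\<Omega> n) X)" "bdeg (Suc d) (\<delta> * poly_at (\<Theta> n) X)"
    using bdeg_mult[OF bdeg_roots(3) p(2)] bdeg_mult[OF bdeg_roots(3) p(3)] by simp_all
  have w: "bdeg (Suc d) (2 * poly_at (W n) X)"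
    using bdeg_mono[OF bdeg_const_mult[OF p(1), of 2], of "Suc d"] by simp
  have root: "bdeg (Suc (Suc d)) (\<delta> * poly_at (\<Theta> n) X * (y - fls_const (b n)))" if "bdeg 1 y" for y
    using bdeg_mult[OF dp(2) bdeg_diff[OF that bdeg.const]] by simp
  show h: "bdeg (Suc d) (h1 n)" unfolding h1_def using w dp by (intro bdeg_diff)
  show h': "bdeg (Suc d) (h3 n)" unfolding h3_def using bdeg_uminus[OF w] dp by (intro bdeg_diff) simp_all
  show "bdeg (Suc d) (h2 n)" unfolding h2_def using bdeg_const_mult[OF dp(2)] by (simp add: mult.assoc)
  show "bdeg (Suc (Suc d)) (l1 n)" unfolding l1_def
    using bdeg_mono[OF bdeg_uminus[OF bdeg_const_mult[OF dp(2)]], of "Suc (Suc d)"] by (simp add: mult.assoc)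
  show "bdeg (Suc (Suc d)) (l2 n)" unfolding l2_def using bdeg_mono[OF h, of "Suc (Suc d)"] root[OF bdeg_roots(2)]
    unfolding h1_def by (intro bdeg.add) simp_all
  show "bdeg (Suc (Suc d)) (l4 n)" unfolding l4_def using bdeg_mono[OF h', of "Suc (Suc d)"] root[OF bdeg_roots(1)]
    unfolding h3_def by (intro bdeg.add) simp_all
qed

lemma represents_relation_form_Suc: "represents n (d + 2) (relation_form (Suc n)) (h1 (Suc n)) (h2 (Suc n)) (h3 (Suc n)) (h2 (Suc n))"
  unfolding represents_def
proof (intro conjI allI impI)
  fix f g
  show "relation_form (Suc n) f g = h1 (Suc n) * f (Suc n) + h2 (Suc n) * f n + h3 (Suc n) * g (Suc n) + h2 (Suc n) * g n"
    unfolding relation_form_def h1_def h2_def h3_def diff_Suc_1 by algebra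
qed (use bdeg_coeffs[of "Suc n"] bdeg_mono[of "Suc d" _ "d + 2"] in auto)

lemma represents_relation_form:
  assumes "n \<ge> 1" shows "represents n (d + 2) (relation_form n) (l1 n) (l2 n) (l1 n) (l4 n)"
  unfolding represents_def
proof (intro conjI allI impI)
  fix f g assume "solves \<phi>2 f" "solves \<phi>1 g"
  then have "fls_const (a (Suc n)) * f (Suc n) = (\<phi>2 - fls_const (b n)) * f n - fls_const (a n) * f (n - 1)"
    "fls_const (a (Suc n)) * g (Suc n) = (\<phi>1 - fls_const (b n)) * g n - fls_const (a n) * g (n - 1)"
    using assms unfolding solves_def by auto
  then show "relation_form n f g = l1 n * f (Suc n) + l2 n * f n + l1 n * g (Suc n) + l4 n * g n"
    unfolding relation_form_def l1_def l2_def l4_def by algebra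
qed (use bdeg_coeffs[OF assms] in auto)

lemma represents_relation_form_add:
  "\<exists>c1 c2 c3 c4. represents n (d + 2 + j) (relation_form (Suc n + j)) c1 c2 c3 c4"
proof (induction j arbitrary: n)
  case 0 show ?case using represents_relation_form_Suc[of n] by auto
next
  case (Suc j)
  from Suc[of "Suc n"] show ?case using represents_down[of n "d + 2 + j"] by fastforce
qed

section \<open>The common kernel of the relations\<close>

abbreviation "P2 n \<equiv> poly_at (P n) \<phi>2"
abbreviation "P1 n \<equiv> poly_at (P n) \<phi>1"

lemma P_val_nz: "P1 n \<noteq> 0" "P2 n \<noteq> 0"
  using P_nz by (simp_all add: poly_at_eq_0_iff subdegree_roots)

text \<open>
  Eliminating the values at $y_2$ leaves relations at $y_1$ alone, which are trivial. So if the
  $y_2$-parts of two bounded-degree relations satisfied by $P$ are dependent, the relations are dependent.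
\<close>

lemma kernel_minors:
  assumes n: "n > 8 * k + 2"
    and bdeg: "bdeg k c1" "bdeg k c2" "bdeg k c3" "bdeg k c4" "bdeg k d1" "bdeg k d2" "bdeg k d3" "bdeg k d4"
    and c: "c1 * P2 (Suc n) + c2 * P2 n + c3 * P1 (Suc n) + c4 * P1 n = 0"
    and d: "d1 * P2 (Suc n) + d2 * P2 n + d3 * P1 (Suc n) + d4 * P1 n = 0"
    and minor: "c1 * d2 = c2 * d1"
  shows "c1 * d3 = c3 * d1 \<and> c1 * d4 = c4 * d1 \<and> c2 * d3 = c3 * d2 \<and> c2 * d4 = c4 * d2 \<and> c3 * d4 = c4 * d3"
proof -
  have n2: "n > 4 * (2 * k) + 2" using n by simp
  have B: "bdeg (2 * k) (u * v - u' * v')" if "bdeg k u" "bdeg k v" "bdeg k u'" "bdeg k v'" for u v u' v'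
    using bdeg_diff[OF bdeg_mult[OF that(1,2)] bdeg_mult[OF that(3,4)]] by (simp add: mult_2)
  have "(c3 * d1 - c1 * d3) * P1 (Suc n) + (c4 * d1 - c1 * d4) * P1 n = 0"
    using c d minor by algebra
  then have 1: "c3 * d1 - c1 * d3 = 0 \<and> c4 * d1 - c1 * d4 = 0"
    using bdeg by (intro no_small_relation[OF n2, of _ _ \<phi>1] B) auto
  have "(c3 * d2 - c2 * d3) * P1 (Suc n) + (c4 * d2 - c2 * d4) * P1 n = 0"
    using c d minor by algebra
  then have 2: "c3 * d2 - c2 * d3 = 0 \<and> c4 * d2 - c2 * d4 = 0"
    using bdeg by (intro no_small_relation[OF n2, of _ _ \<phi>1] B) auto
  have "(c4 * d3 - c3 * d4) * P1 n = 0"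
    using c d 1 2 by algebra
  then have "c4 * d3 - c3 * d4 = 0" using P_val_nz by simp
  with 1 2 show ?thesis by simp
qed

text \<open>
  The forms of index $n$ and $n + 1$ are independent; by \<open>kernel_minors\<close> it is enough to look at the
  values at $y_2$.
\<close>

definition transversal :: "nat \<Rightarrow> bool" where
  "transversal n \<longleftrightarrow> h1 (Suc n) * l2 n \<noteq> h2 (Suc n) * l1 n"

lemma represents_kills_P:
  assumes "represents n k (relation_form m) c1 c2 c3 c4" "m \<ge> 1"
  shows "c1 * P2 (Suc n) + c2 * P2 n + c3 * P1 (Suc n) + c4 * P1 n = 0"
proof -
  have "relation_form m P2 P1 = c1 * P2 (Suc n) + c2 * P2 n + c3 * P1 (Suc n) + c4 * P1 n"
    using assms solves_P[of \<phi>2] solves_P[of \<phi>1] unfolding represents_def by blast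
  then show ?thesis using relation_form_P[OF assms(2)] by simp
qed

lemma poly_at_X_eq_0: "poly_at p X = 0 \<longleftrightarrow> p = 0"
  by (rule poly_at_eq_0_iff[OF x_inf_subdegree])

text \<open>
  The form of index $n$ has equal first and third coefficients, and the form of index $n + 1$ has equal
  second and fourth ones. If the two nonzero forms are proportional, each equality holds for both of them,
  which means $4 W_{n+1} = 0$ and $4 W_n + \delta^2 \Theta_n = 0$.
\<close>

lemma dependent_pair:
  assumes n: "n > 8 * (d + 2) + 2" and ng: "\<not> transversal n"
  shows "W (Suc n) = 0" "4 * poly_at (W n) X + \<delta> ^ 2 * poly_at (\<Theta> n) X = 0"
    "h1 (Suc n) * l2 n = h2 (Suc n) * l1 n"
proof -
  have n1: "n \<ge> 1" using n by simp
  note rh = represents_relation_form_Suc[of n] and rl = represents_relation_form[OF n1]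
  show m12: "h1 (Suc n) * l2 n = h2 (Suc n) * l1 n" using ng by (simp add: transversal_def)
  define w o' th where w: "w = poly_at (W n) X" and o': "o' = poly_at (\<Omega> n) X" and th: "th = poly_at (\<Theta> n) X"
  define w2 o2 th2 where w2: "w2 = poly_at (W (Suc n)) X" and o2: "o2 = poly_at (\<Omega> (Suc n)) X"
    and th2: "th2 = poly_at (\<Theta> (Suc n)) X"
  have nz: "\<not> (w = 0 \<and> o' = 0 \<and> th = 0)" "\<not> (w2 = 0 \<and> o2 = 0 \<and> th2 = 0)"
    using nontrivial[OF n1] nontrivial[of "Suc n"] unfolding w o' th w2 o2 th2 poly_at_X_eq_0 by auto
  have m: "h1 (Suc n) * l1 n = h3 (Suc n) * l1 n \<and> h1 (Suc n) * l4 n = h2 (Suc n) * l1 n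
    \<and> h2 (Suc n) * l1 n = h3 (Suc n) * l2 n \<and> h2 (Suc n) * l4 n = h2 (Suc n) * l2 n \<and> h3 (Suc n) * l4 n = h2 (Suc n) * l1 n"
    using rh rl unfolding represents_def
    by (intro kernel_minors[OF n _ _ _ _ _ _ _ _ represents_kills_P[OF rh] represents_kills_P[OF rl n1] m12]) auto
  have a: "fls_const (a (Suc n)) \<noteq> 0" using a_nz[of "Suc n"] by simp
  have hs: "h1 (Suc n) = 2 * w2 - \<delta> * o2" "h3 (Suc n) = - 2 * w2 - \<delta> * o2" "h2 (Suc n) = fls_const (a (Suc n)) * \<delta> * th2"
    "l1 n = - fls_const (a (Suc n)) * \<delta> * th" "l2 n = 2 * w - \<delta> * o' + \<delta> * th * (\<phi>2 - fls_const (b n))"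
    "l4 n = - 2 * w - \<delta> * o' + \<delta> * th * (\<phi>1 - fls_const (b n))"
    unfolding h1_def h2_def h3_def l1_def l2_def l4_def w o' th w2 o2 th2 by simp_all
  have hd: "h1 (Suc n) - h3 (Suc n) = 4 * w2" unfolding hs by algebra
  have ld: "l2 n - l4 n = 4 * w + \<delta> ^ 2 * th" unfolding hs \<delta>_def by algebra
  have "w2 = 0"
  proof (rule ccontr)
    assume w2: "w2 \<noteq> 0"
    then have h13: "h1 (Suc n) \<noteq> h3 (Suc n)" using hd by auto
    with m have "l1 n = 0" by simp
    with a \<delta>_nz have th: "th = 0" unfolding hs by simp
    have "l2 n = 0" using h13 m m12 \<open>l1 n = 0\<close> by auto
    moreover have "l4 n = 0" using h13 m m12 \<open>l1 n = 0\<close> by auto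
    ultimately have "2 * w - \<delta> * o' = 0" "- 2 * w - \<delta> * o' = 0" unfolding hs th by simp_all
    then have "4 * w = 0" "2 * (\<delta> * o') = 0" by algebra+
    with \<delta>_nz th nz show False by simp
  qed
  then show "W (Suc n) = 0" unfolding w2 poly_at_X_eq_0 .
  show "4 * poly_at (W n) X + \<delta> ^ 2 * poly_at (\<Theta> n) X = 0"
  proof (rule ccontr)
    assume "\<not> ?thesis"
    then have l24: "l2 n \<noteq> l4 n" using ld unfolding w th by auto
    with m have h2: "h2 (Suc n) = 0" by auto
    with a \<delta>_nz have th: "th2 = 0" unfolding hs by simp
    have "h1 (Suc n) = 0" using m m12 h2 l24 by auto
    then have "o2 = 0" unfolding hs \<open>w2 = 0\<close> using \<delta>_nz by simp
    with th \<open>w2 = 0\<close> nz show False by simp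
  qed
qed

text \<open>
  Three dependent consecutive pairs would force $W$ and $\Theta$ to vanish at the indices $n + 1$ and
  $n + 2$. The two relations would then say $\mathcal M p_{n+1} = 0$ and $\mathcal M p_{n+2} = 0$, which are
  independent forms. A single dependent pair cannot be excluded: when $\mu$ is symmetric and
  $y_2 = - y_1$, the relation $\mathcal M p_n = 0$ holds for all odd $n$ and can be the hypothesis at both
  $n$ and $n + 1$.
\<close>

lemma transversal_exists:
  assumes n: "n > 8 * (d + 2) + 2"
  shows "transversal n \<or> transversal (Suc n) \<or> transversal (Suc (Suc n))"
proof (rule ccontr)
  assume "\<not> ?thesis"
  then have ng: "\<not> transversal n" "\<not> transversal (Suc n)" "\<not> transversal (Suc (Suc n))" by auto
  have W: "W (Suc n) = 0" "W (Suc (Suc n)) = 0"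
    using dependent_pair(1)[OF n ng(1)] dependent_pair(1)[of "Suc n"] ng n by simp_all
  have Th: "\<Theta> (Suc n) = 0" "\<Theta> (Suc (Suc n)) = 0"
    using dependent_pair(2)[of "Suc n"] dependent_pair(2)[of "Suc (Suc n)"] ng n W \<delta>_nz by (simp_all add: poly_at_X_eq_0)
  have "\<Omega> (Suc n) \<noteq> 0" "\<Omega> (Suc (Suc n)) \<noteq> 0"
    using nontrivial[of "Suc n"] nontrivial[of "Suc (Suc n)"] W Th by auto
  moreover have "h1 (Suc (Suc n)) * l2 (Suc n) = h2 (Suc (Suc n)) * l1 (Suc n)"
    using dependent_pair(3)[of "Suc n"] ng n by simp
  ultimately show False
    using \<delta>_nz unfolding h1_def l2_def h2_def l1_def W Th by (simp add: poly_at_X_eq_0)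
qed

text \<open>
  Cramer's rule expresses the $y_2$-part of the third relation through the first two; the difference is
  then a relation at $y_1$ alone, of degree $3k$, and hence trivial.
\<close>

lemma third_relation:
  assumes n: "n > 12 * k + 2"
    and bdeg: "bdeg k c1" "bdeg k c2" "bdeg k c3" "bdeg k c4" "bdeg k d1" "bdeg k d2" "bdeg k d3" "bdeg k d4"
       "bdeg k e1" "bdeg k e2" "bdeg k e3" "bdeg k e4"
    and c: "c1 * P2 (Suc n) + c2 * P2 n + c3 * P1 (Suc n) + c4 * P1 n = 0"
    and d: "d1 * P2 (Suc n) + d2 * P2 n + d3 * P1 (Suc n) + d4 * P1 n = 0"
    and e: "e1 * P2 (Suc n) + e2 * P2 n + e3 * P1 (Suc n) + e4 * P1 n = 0"
    and minor: "c1 * d2 \<noteq> c2 * d1"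
    and x: "c1 * x1 + c2 * x2 + c3 * x3 + c4 * x4 = 0" "d1 * x1 + d2 * x2 + d3 * x3 + d4 * x4 = 0"
  shows "e1 * x1 + e2 * x2 + e3 * x3 + e4 * x4 = 0"
proof -
  have n3: "n > 4 * (2 * k + k) + 2" using n by simp
  have B: "bdeg (2 * k) (u * v - u' * v')" if "bdeg k u" "bdeg k v" "bdeg k u'" "bdeg k v'" for u v u' v'
    using bdeg_diff[OF bdeg_mult[OF that(1,2)] bdeg_mult[OF that(3,4)]] by (simp add: mult_2)
  \<comment> \<open>the factors of Cramer's rule for the first two components\<close>
  define D l m where "D = c1 * d2 - c2 * d1" and "l = e1 * d2 - e2 * d1" and "m = c1 * e2 - c2 * e1"
  have BD: "bdeg (2 * k) D" "bdeg (2 * k) l" "bdeg (2 * k) m"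
    unfolding D_def l_def m_def using bdeg by (auto intro!: B)
  have B3: "bdeg (2 * k + k) (D * u - l * v - m * w)" if "bdeg k u" "bdeg k v" "bdeg k w" for u v w
    using BD that by (intro bdeg_diff bdeg_mult)
  have "(D * e3 - l * c3 - m * d3) * P1 (Suc n) + (D * e4 - l * c4 - m * d4) * P1 n = 0"
    using c d e unfolding D_def l_def m_def by algebra
  then have z: "D * e3 - l * c3 - m * d3 = 0 \<and> D * e4 - l * c4 - m * d4 = 0"
    using bdeg by (intro no_small_relation[OF n3, of _ _ \<phi>1] B3) auto
  have "D * (e1 * x1 + e2 * x2 + e3 * x3 + e4 * x4) =
      l * (c1 * x1 + c2 * x2 + c3 * x3 + c4 * x4) + m * (d1 * x1 + d2 * x2 + d3 * x3 + d4 * x4)"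
    using z unfolding D_def l_def m_def by algebra
  then have "D * (e1 * x1 + e2 * x2 + e3 * x3 + e4 * x4) = 0" using x by simp
  moreover have "D \<noteq> 0" using minor by (simp add: D_def)
  ultimately show ?thesis by (metis mult_eq_0_iff)
qed

lemma kernel_persists:
  assumes n: "n > 12 * (d + 5) + 2" and transversal: "transversal n" and f: "solves \<phi>2 f" and g: "solves \<phi>1 g"
    and z: "relation_form n f g = 0" "relation_form (Suc n) f g = 0" and j: "j \<le> 3"
  shows "relation_form (Suc n + j) f g = 0"
proof -
  have n1: "n \<ge> 1" using n by simp
  have k: "d + 2 \<le> d + 5" "d + 2 + j \<le> d + 5" using j by auto
  note rh = represents_mono[OF represents_relation_form_Suc[of n] k(1)]
    and rl = represents_mono[OF represents_relation_form[OF n1] k(1)]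
  obtain c1 c2 c3 c4 where rc: "represents n (d + 5) (relation_form (Suc n + j)) c1 c2 c3 c4"
    using represents_relation_form_add[of n j] represents_mono[OF _ k(2)] by blast
  have "c1 * f (Suc n) + c2 * f n + c3 * g (Suc n) + c4 * g n = 0"
  proof (rule third_relation[OF n _ _ _ _ _ _ _ _ _ _ _ _ represents_kills_P[OF rh] represents_kills_P[OF rl n1] represents_kills_P[OF rc]])
    show "h1 (Suc n) * l2 n \<noteq> h2 (Suc n) * l1 n" using transversal by (simp add: transversal_def)
    show "h1 (Suc n) * f (Suc n) + h2 (Suc n) * f n + h3 (Suc n) * g (Suc n) + h2 (Suc n) * g n = 0"
      using rh f g z(2) unfolding represents_def by metis
    show "l1 n * f (Suc n) + l2 n * f n + l1 n * g (Suc n) + l4 n * g n = 0"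
      using rl f g z(1) unfolding represents_def by metis
  qed (use rh rl rc in \<open>auto simp: represents_def\<close>)
  then show ?thesis using rc f g unfolding represents_def by metis
qed

text \<open>
  Within the next three indices there is again an independent pair, and its forms lie in the span of the
  present pair.
\<close>

lemma kernel_persists_infinitely:
  assumes n: "n > 12 * (d + 5) + 2" and transversal: "transversal n" and f: "solves \<phi>2 f" and g: "solves \<phi>1 g"
    and z: "relation_form n f g = 0" "relation_form (Suc n) f g = 0"
  shows "\<exists>m\<ge>N. transversal m \<and> relation_form m f g = 0 \<and> relation_form (Suc m) f g = 0"
proof -
  have "\<exists>m\<ge>n + N. transversal m \<and> relation_form m f g = 0 \<and> relation_form (Suc m) f g = 0"
  proof (induction N)
    case 0 then show ?case using transversal z by auto
  next
    case (Suc N)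
    then obtain m where m: "m \<ge> n + N" "transversal m" "relation_form m f g = 0" "relation_form (Suc m) f g = 0" by blast
    then have mn: "m > 12 * (d + 5) + 2" using n by simp
    note ker = kernel_persists[OF mn m(2) f g m(3,4)]
    have "transversal (Suc m) \<or> transversal (Suc (Suc m)) \<or> transversal (Suc (Suc (Suc m)))"
      using mn by (intro transversal_exists) simp
    then obtain j where j: "j \<le> 2" "transversal (Suc m + j)"
    proof (elim disjE)
      assume "transversal (Suc m)" then show thesis using that[of 0] by simp
    next
      assume "transversal (Suc (Suc m))" then show thesis using that[of 1] by simp
    next
      assume "transversal (Suc (Suc (Suc m)))" then show thesis using that[of 2] by (simp add: numeral_2_eq_2)
    qed
    have "relation_form (Suc m + j) f g = 0" "relation_form (Suc (Suc m + j)) f g = 0"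
      using ker[of j] ker[of "Suc j"] j by simp_all
    then show ?case using j m(1) by (intro exI[of _ "Suc m + j"]) auto
  qed
  then show ?thesis by (meson le_add2 order_trans)
qed

section \<open>The equation for the Stieltjes function\<close>

text \<open>
  In the coordinates $(\alpha_2 - \alpha_1)/\delta$, $\beta_2 - \beta_1$, $\beta_2 + \beta_1$ the coefficients
  are built from divided differences and means of $P_n$ and $Q_n$, hence are polynomials in $x$. The
  coordinate $\alpha_2 + \alpha_1$ does not appear because the form vanishes on $P$.
\<close>

lemma relation_form_coordinates:
  assumes n: "n \<ge> 1"
  shows "\<exists>L1 L2 L3. \<forall>\<alpha>2 \<beta>2 \<alpha>1 \<beta>1.
    2 * relation_form n (\<lambda>n. \<alpha>2 * P2 n + \<beta>2 * poly_at (Q n) \<phi>2) (\<lambda>n. \<alpha>1 * P1 n + \<beta>1 * poly_at (Q n) \<phi>1)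
    = (\<alpha>2 - \<alpha>1) * poly_at L1 X + (\<beta>2 - \<beta>1) * poly_at L2 X + \<delta> * (\<beta>2 + \<beta>1) * poly_at L3 X"
proof -
  obtain dp mp where p: "poly_at (P n) \<phi>2 - poly_at (P n) \<phi>1 = \<delta> * poly_at dp X"
    "poly_at (P n) \<phi>1 + poly_at (P n) \<phi>2 = 2 * poly_at mp X" using symmetric_values by blast
  obtain dp' mp' where p': "poly_at (P (n-1)) \<phi>2 - poly_at (P (n-1)) \<phi>1 = \<delta> * poly_at dp' X"
    "poly_at (P (n-1)) \<phi>1 + poly_at (P (n-1)) \<phi>2 = 2 * poly_at mp' X" using symmetric_values by blast
  obtain dq mq where q: "poly_at (Q n) \<phi>2 - poly_at (Q n) \<phi>1 = \<delta> * poly_at dq X"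
    "poly_at (Q n) \<phi>1 + poly_at (Q n) \<phi>2 = 2 * poly_at mq X" using symmetric_values by blast
  obtain dq' mq' where q': "poly_at (Q (n-1)) \<phi>2 - poly_at (Q (n-1)) \<phi>1 = \<delta> * poly_at dq' X"
    "poly_at (Q (n-1)) \<phi>1 + poly_at (Q (n-1)) \<phi>2 = 2 * poly_at mq' X" using symmetric_values by blast
  define c where "c = fls_const (a n)"
  define L1 where "L1 = smult 4 (W n * mp) - disc * (\<Omega> n * dp - smult (a n) (\<Theta> n * dp'))"
  define L2 where "L2 = smult 4 (W n * mq) - disc * (\<Omega> n * dq - smult (a n) (\<Theta> n * dq'))"
  define L3 where "L3 = smult 2 (W n * dq - \<Omega> n * mq + smult (a n) (\<Theta> n * mq'))"
  have cs: "fls_const 4 = (4 :: complex fls)" "fls_const 2 = (2 :: complex fls)" by simp_all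
  note rel = relation[OF n, folded c_def]
  show ?thesis
  proof (rule exI[of _ L1], rule exI[of _ L2], rule exI[of _ L3], intro allI)
    fix \<alpha>2 \<beta>2 \<alpha>1 \<beta>1
    show "2 * relation_form n (\<lambda>n. \<alpha>2 * P2 n + \<beta>2 * poly_at (Q n) \<phi>2) (\<lambda>n. \<alpha>1 * P1 n + \<beta>1 * poly_at (Q n) \<phi>1)
    = (\<alpha>2 - \<alpha>1) * poly_at L1 X + (\<beta>2 - \<beta>1) * poly_at L2 X + \<delta> * (\<beta>2 + \<beta>1) * poly_at L3 X"
      unfolding relation_form_def L1_def L2_def L3_def poly_at_diff poly_at_add poly_at_mult poly_at_smult cs \<delta>_sq[symmetric] c_def[symmetric]
      using p p' q q' rel by algebra
  qed
qed

abbreviation "Q2 n \<equiv> poly_at (Q n) \<phi>2"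
abbreviation "Q1 n \<equiv> poly_at (Q n) \<phi>1"

text \<open>
  $(K_1, K_2, K_3)$ is the cross product of the coefficient vectors of two independent forms. If it
  vanished, the two forms would be proportional, and evaluating them on the pairs $(P, 0)$ and $(Q, 0)$
  would contradict the independence, as the Casoratian is not zero.
\<close>

lemma kernel_element:
  assumes n: "n \<ge> 1" and transversal: "transversal n"
  shows "\<exists>K1 K2 K3. \<not> (K1 = 0 \<and> K2 = 0 \<and> K3 = 0) \<and>
    (\<forall>\<alpha>2 \<beta>2 \<alpha>1 \<beta>1. \<alpha>2 - \<alpha>1 = 2 * \<delta> * poly_at K1 X \<longrightarrow> \<beta>2 = poly_at K3 X + \<delta> * poly_at K2 X \<longrightarrow>
       \<beta>1 = poly_at K3 X - \<delta> * poly_at K2 X \<longrightarrow>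
       relation_form n (\<lambda>n. \<alpha>2 * P2 n + \<beta>2 * Q2 n) (\<lambda>n. \<alpha>1 * P1 n + \<beta>1 * Q1 n) = 0 \<and>
       relation_form (Suc n) (\<lambda>n. \<alpha>2 * P2 n + \<beta>2 * Q2 n) (\<lambda>n. \<alpha>1 * P1 n + \<beta>1 * Q1 n) = 0)"
proof -
  obtain L1 L2 L3 where L: "\<And>\<alpha>2 \<beta>2 \<alpha>1 \<beta>1.
    2 * relation_form n (\<lambda>n. \<alpha>2 * P2 n + \<beta>2 * Q2 n) (\<lambda>n. \<alpha>1 * P1 n + \<beta>1 * Q1 n)
    = (\<alpha>2 - \<alpha>1) * poly_at L1 X + (\<beta>2 - \<beta>1) * poly_at L2 X + \<delta> * (\<beta>2 + \<beta>1) * poly_at L3 X"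
    using relation_form_coordinates[OF n] by blast
  obtain M1 M2 M3 where M: "\<And>\<alpha>2 \<beta>2 \<alpha>1 \<beta>1.
    2 * relation_form (Suc n) (\<lambda>n. \<alpha>2 * P2 n + \<beta>2 * Q2 n) (\<lambda>n. \<alpha>1 * P1 n + \<beta>1 * Q1 n)
    = (\<alpha>2 - \<alpha>1) * poly_at M1 X + (\<beta>2 - \<beta>1) * poly_at M2 X + \<delta> * (\<beta>2 + \<beta>1) * poly_at M3 X"
    using relation_form_coordinates[of "Suc n"] by auto
  define K1 K2 K3 where K: "K1 = L2 * M3 - L3 * M2" "K2 = L3 * M1 - L1 * M3" "K3 = L1 * M2 - L2 * M1"
  have "\<not> (K1 = 0 \<and> K2 = 0 \<and> K3 = 0)"
  proof
    assume K0: "K1 = 0 \<and> K2 = 0 \<and> K3 = 0"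
    have "poly_at K2 X = 0" "poly_at K3 X = 0" using K0 by simp_all
    note K0 = this[unfolded K poly_at_diff poly_at_mult]
    define p q z where "p = (\<lambda>n. 1 * P2 n + 0 * Q2 n)" and "q = (\<lambda>n. 0 * P2 n + 1 * Q2 n)"
      and "z = (\<lambda>n. 0 * P1 n + 0 * Q1 n)"
    have s: "solves \<phi>2 p" "solves \<phi>2 q" "solves \<phi>1 z" unfolding p_def q_def z_def
      using solves_P solves_Q solves_combination[OF solves_P solves_Q] solves_0 by auto
    have "(2 * relation_form n p z) * (2 * relation_form (Suc n) q z) = (2 * relation_form n q z) * (2 * relation_form (Suc n) p z)"
      unfolding p_def q_def z_def L M using K0 by algebra
    then have e: "relation_form n p z * relation_form (Suc n) q z = relation_form n q z * relation_form (Suc n) p z" by simp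
    have r: "relation_form n f z = l1 n * f (Suc n) + l2 n * f n"
      "relation_form (Suc n) f z = h1 (Suc n) * f (Suc n) + h2 (Suc n) * f n" if "solves \<phi>2 f" for f
      using represents_relation_form[OF n] represents_relation_form_Suc[of n] that s(3) unfolding represents_def z_def by auto
    obtain \<kappa> where k: "\<kappa> \<noteq> 0" "P n * Q (Suc n) - P (Suc n) * Q n = [:\<kappa>:]" using casoratian by blast
    have "poly_at (P n * Q (Suc n) - P (Suc n) * Q n) \<phi>2 \<noteq> 0" unfolding k(2) using k(1) by simp
    then have cas: "P2 n * Q2 (Suc n) - P2 (Suc n) * Q2 n \<noteq> 0" by simp
    have pq: "p = P2" "q = Q2" unfolding p_def q_def by simp_all
    have "(h1 (Suc n) * l2 n - h2 (Suc n) * l1 n) * (P2 n * Q2 (Suc n) - P2 (Suc n) * Q2 n) = 0"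
      using e unfolding r[OF s(1)] r[OF s(2)] unfolding pq by algebra
    with cas transversal show False unfolding transversal_def by simp
  qed
  moreover have "relation_form n (\<lambda>n. \<alpha>2 * P2 n + \<beta>2 * Q2 n) (\<lambda>n. \<alpha>1 * P1 n + \<beta>1 * Q1 n) = 0 \<and>
       relation_form (Suc n) (\<lambda>n. \<alpha>2 * P2 n + \<beta>2 * Q2 n) (\<lambda>n. \<alpha>1 * P1 n + \<beta>1 * Q1 n) = 0"
    if h: "\<alpha>2 - \<alpha>1 = 2 * \<delta> * poly_at K1 X" "\<beta>2 = poly_at K3 X + \<delta> * poly_at K2 X" "\<beta>1 = poly_at K3 X - \<delta> * poly_at K2 X"
    for \<alpha>2 \<beta>2 \<alpha>1 \<beta>1
  proof -
    have "2 * relation_form n (\<lambda>n. \<alpha>2 * P2 n + \<beta>2 * Q2 n) (\<lambda>n. \<alpha>1 * P1 n + \<beta>1 * Q1 n) = 0"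
      unfolding L h unfolding K poly_at_diff poly_at_mult by algebra
    moreover have "2 * relation_form (Suc n) (\<lambda>n. \<alpha>2 * P2 n + \<beta>2 * Q2 n) (\<lambda>n. \<alpha>1 * P1 n + \<beta>1 * Q1 n) = 0"
      unfolding M h unfolding K poly_at_diff poly_at_mult by algebra
    ultimately show ?thesis by simp
  qed
  ultimately show ?thesis by blast
qed

lemma ord_ge_exists: "\<exists>m. ord_ge m f"
  unfolding ord_ge_def by blast

text \<open>
  Eliminating $f_n$ from the two independent relations expresses $D\,e\,p_{n+1}(y_2)$, where $D$ is
  a nonzero minor of bounded degree, through terms of order at least $2n$ up to a constant. The left-hand
  side has order at most $-2n$ up to a constant, since $D$ cannot be small.
\<close>

lemma kernel_growth:
  assumes inf: "\<And>N. \<exists>n\<ge>N. transversal n \<and> relation_form n f g = 0 \<and> relation_form (Suc n) f g = 0"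
    and f: "solves \<phi>2 f" and g: "solves \<phi>1 g"
    and fe: "\<And>n. f n = e * P2 n + u n" and small: "\<And>n. ord_ge (2 * int n + m) (u n)" "\<And>n. ord_ge (2 * int n + m) (g n)"
  shows "e = 0"
proof (rule ccontr)
  assume e: "e \<noteq> 0"
  define k where "k = d + 2 + (d + 2)"
  obtain M where M: "\<And>u. bdeg k u \<Longrightarrow> u \<noteq> 0 \<Longrightarrow> fls_subdegree u \<le> M"
    using bdeg_subdegree_bounded by blast
  obtain n where n: "n \<ge> Suc (nat (M + fls_subdegree e - 2 - m + 2 * int k))" and transversal: "transversal n"
    and z: "relation_form n f g = 0" "relation_form (Suc n) f g = 0"
    using inf by blast
  have n1: "n \<ge> 1" using n by simp
  note rh = represents_relation_form_Suc[of n] and rl = represents_relation_form[OF n1]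
  define D where "D = h1 (Suc n) * l2 n - h2 (Suc n) * l1 n"
  have D0: "D \<noteq> 0" using transversal by (simp add: D_def transversal_def)
  have B: "bdeg k (u * v - u' * v')" if "bdeg (d + 2) u" "bdeg (d + 2) v" "bdeg (d + 2) u'" "bdeg (d + 2) v'" for u v u' v'
    unfolding k_def using that by (intro bdeg_diff bdeg_mult)
  have BD: "bdeg k D" unfolding D_def using rh rl by (intro B) (auto simp: represents_def)
  have eq: "D * (e * P2 (Suc n)) = - (D * u (Suc n) + (h3 (Suc n) * l2 n - h2 (Suc n) * l1 n) * g (Suc n)
      + (h2 (Suc n) * l2 n - h2 (Suc n) * l4 n) * g n)"
  proof -
    have "h1 (Suc n) * f (Suc n) + h2 (Suc n) * f n + h3 (Suc n) * g (Suc n) + h2 (Suc n) * g n = 0"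
      using rh f g z(2) unfolding represents_def by metis
    moreover have "l1 n * f (Suc n) + l2 n * f n + l1 n * g (Suc n) + l4 n * g n = 0"
      using rl f g z(1) unfolding represents_def by metis
    moreover note fe[of "Suc n"]
    ultimately show ?thesis unfolding D_def by algebra
  qed
  have small': "ord_ge (- 2 * int k + (2 * int n + m)) (c * v)" if "bdeg k c" "ord_ge (2 * int n + m) v" for c v
    using ord_ge_mult[OF ord_ge_bdeg[OF that(1)] that(2)] .
  have "ord_ge (- 2 * int k + (2 * int n + m)) (D * (e * P2 (Suc n)))"
    unfolding eq
    using rh rl BD small(2)[of n] ord_ge_mono[OF small(1)[of "Suc n"], of "2 * int n + m"]
      ord_ge_mono[OF small(2)[of "Suc n"], of "2 * int n + m"]
    by (intro ord_ge_uminus ord_ge_add small' B) (auto simp: represents_def)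
  then have "- 2 * int k + (2 * int n + m) \<le> fls_subdegree D + (fls_subdegree e + fls_subdegree (P2 (Suc n)))"
    using D0 e P_val_nz unfolding ord_ge_def by simp
  moreover have "fls_subdegree (P2 (Suc n)) = - 2 * int (Suc n)"
    using poly_at_subdegree[OF subdegree_roots(2) P_nz[of "Suc n"]] by (simp add: degree_P)
  moreover have "fls_subdegree D \<le> M" using M BD D0 by blast
  moreover have "int n > M + fls_subdegree e - 2 - m + 2 * int k" "int n \<ge> 0"
    using n by linarith+
  ultimately show False by simp
qed

lemma semi_classical:
  "\<exists>W V U :: complex poly. \<not> (W = 0 \<and> V = 0 \<and> U = 0) \<and>
     poly_at W X * ((S2 - S1) / (\<phi>2 - \<phi>1)) = 2 * poly_at V X * ((S1 + S2) / 2) + poly_at U X"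
proof -
  define n0 where "n0 = 12 * (d + 5) + 3"
  have "transversal n0 \<or> transversal (Suc n0) \<or> transversal (Suc (Suc n0))" by (rule transversal_exists) (simp add: n0_def)
  then obtain n where n: "n \<ge> n0" "transversal n" by (metis le_Suc_eq order_refl)
  have nn: "n > 12 * (d + 5) + 2" "n \<ge> 1" using n by (simp_all add: n0_def)
  obtain K1 K2 K3 where nz: "\<not> (K1 = 0 \<and> K2 = 0 \<and> K3 = 0)" and K: "\<And>\<alpha>2 \<beta>2 \<alpha>1 \<beta>1.
       \<alpha>2 - \<alpha>1 = 2 * \<delta> * poly_at K1 X \<Longrightarrow> \<beta>2 = poly_at K3 X + \<delta> * poly_at K2 X \<Longrightarrow>
       \<beta>1 = poly_at K3 X - \<delta> * poly_at K2 X \<Longrightarrow>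
       relation_form n (\<lambda>n. \<alpha>2 * P2 n + \<beta>2 * Q2 n) (\<lambda>n. \<alpha>1 * P1 n + \<beta>1 * Q1 n) = 0 \<and>
       relation_form (Suc n) (\<lambda>n. \<alpha>2 * P2 n + \<beta>2 * Q2 n) (\<lambda>n. \<alpha>1 * P1 n + \<beta>1 * Q1 n) = 0"
    using kernel_element[OF nn(2) n(2)] by blast
  define \<beta>2 \<beta>1 where \<beta>2: "\<beta>2 = poly_at K3 X + \<delta> * poly_at K2 X" and \<beta>1: "\<beta>1 = poly_at K3 X - \<delta> * poly_at K2 X"
  \<comment> \<open>the multiple of the pair $P$ that turns $g$ into a multiple of the remainder\<close>
  define \<alpha>1 where \<alpha>1: "\<alpha>1 = - \<beta>1 * S1"
  define \<alpha>2 where \<alpha>2: "\<alpha>2 = \<alpha>1 + 2 * \<delta> * poly_at K1 X"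
  define f g where f: "f = (\<lambda>n. \<alpha>2 * P2 n + \<beta>2 * Q2 n)" and g: "g = (\<lambda>n. \<alpha>1 * P1 n + \<beta>1 * Q1 n)"
  have z: "relation_form n f g = 0" "relation_form (Suc n) f g = 0"
    using K[OF _ \<beta>2 \<beta>1, of \<alpha>2 \<alpha>1] unfolding f g by (auto simp: \<alpha>2)
  have sol: "solves \<phi>2 f" "solves \<phi>1 g"
    unfolding f g using solves_P solves_Q by (auto intro!: solves_combination)
  obtain m2 where m2: "ord_ge m2 (- \<beta>2)" using ord_ge_exists by blast
  obtain m1 where m1: "ord_ge m1 (- \<beta>1)" using ord_ge_exists by blast
  define m where "m = min m1 m2"
  have m: "ord_ge m (- \<beta>2)" "ord_ge m (- \<beta>1)" unfolding m_def using m1 m2 ord_ge_mono by auto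
  define e where e: "e = \<alpha>2 + \<beta>2 * S2"
  have "e = 0"
  proof (rule kernel_growth[OF _ sol])
    show "\<exists>n\<ge>N. transversal n \<and> relation_form n f g = 0 \<and> relation_form (Suc n) f g = 0" for N
      by (rule kernel_persists_infinitely[OF nn(1) n(2) sol z])
    show "f n = e * P2 n + - \<beta>2 * (P2 n * S2 - Q2 n)" for n unfolding f e by algebra
    show "ord_ge (2 * int n + m) (- \<beta>2 * (P2 n * S2 - Q2 n))" for n
      using ord_ge_mult[OF m(1) remainder2[of n]] by (simp add: add.commute)
    have "g n = - \<beta>1 * (P1 n * S1 - Q1 n)" for n unfolding g \<alpha>1 by algebra
    then show "ord_ge (2 * int n + m) (g n)" for n
      using ord_ge_mult[OF m(2) remainder1[of n]] by (simp add: add.commute)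
  qed
  then have eq: "poly_at K3 X * (S2 - S1) + \<delta> * poly_at K2 X * (S1 + S2) + 2 * \<delta> * poly_at K1 X = 0"
    unfolding e \<alpha>2 \<alpha>1 \<beta>2 \<beta>1 by algebra
  have "poly_at K3 X * ((S2 - S1) / (\<phi>2 - \<phi>1)) = 2 * poly_at (- K2) X * ((S1 + S2) / 2) + poly_at (- smult 2 K1) X"
  proof -
    have "2 * poly_at (- K2) X * ((S1 + S2) / 2) = - (poly_at K2 X * (S1 + S2))" by simp
    moreover have "poly_at (- smult 2 K1) X = - 2 * poly_at K1 X" by simp
    moreover have "poly_at K3 X * (S2 - S1) = \<delta> * (- (poly_at K2 X * (S1 + S2)) - 2 * poly_at K1 X)"
      using eq by algebra
    then have "poly_at K3 X * ((S2 - S1) / \<delta>) = - (poly_at K2 X * (S1 + S2)) - 2 * poly_at K1 X"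
      using \<delta>_nz by (simp add: nonzero_divide_eq_eq mult.commute)
    ultimately show ?thesis unfolding \<delta>_def by simp
  qed
  moreover have "\<not> (K3 = 0 \<and> - K2 = 0 \<and> - smult 2 K1 = 0)" using nz by auto
  ultimately show ?thesis by blast
qed

end

section \<open>Orthonormal polynomials and functions of the second kind\<close>

locale orthonormal_sequence =
  fixes \<mu> :: "real measure" and p :: "nat \<Rightarrow> real poly"
  assumes moments: "\<And>k. integrable \<mu> (\<lambda>t. t ^ k)" and orthonormal: "orthonormal_polys \<mu> p"
begin

definition I :: "real poly \<Rightarrow> real" where "I R = (\<integral>t. poly R t \<partial>\<mu>)"

lemma integrable_poly: "integrable \<mu> (poly R)"
proof -
  have "integrable \<mu> (\<lambda>t. \<Sum>i\<le>degree R. coeff R i * t ^ i)"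
    by (auto intro!: Bochner_Integration.integrable_sum moments)
  then show ?thesis by (simp add: poly_altdef[abs_def])
qed

lemma I_add: "I (R + T) = I R + I T"
  using integrable_poly[of R] integrable_poly[of T] by (simp add: I_def)
lemma I_smult: "I (smult c R) = c * I R"
  by (simp add: I_def)
lemma I_diff: "I (R - T) = I R - I T"
  using integrable_poly[of R] integrable_poly[of T] by (simp add: I_def)
lemma I_0: "I 0 = 0" by (simp add: I_def)

lemma degree_p: "degree (p n) = n" and lead_p: "lead_coeff (p n) > 0"
  using orthonormal unfolding orthonormal_polys_def by blast+

lemma I_p_p: "I (p n * p m) = (if n = m then 1 else 0)"
proof -
  have "poly (p n * p m) = (\<lambda>t. poly (p n) t * poly (p m) t)" by (rule ext) simp
  then show ?thesis using orthonormal unfolding orthonormal_polys_def I_def by simp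
qed

lemma I_low: "degree R < n \<Longrightarrow> I (R * p n) = 0"
proof (induction "degree R" arbitrary: R rule: less_induct)
  case less
  show ?case
  proof (cases "R = 0")
    case False
    define m where "m = degree R"
    define T where "T = R - smult (lead_coeff R / lead_coeff (p m)) (p m)"
    have R: "R = T + smult (lead_coeff R / lead_coeff (p m)) (p m)" by (simp add: T_def)
    have "m < n" using less.prems by (simp add: m_def)
    have lc: "coeff (p m) m > 0" using lead_p[of m] degree_p[of m] by simp
    have dT: "degree T \<le> m" unfolding T_def
      by (intro degree_diff_le) (auto simp: m_def degree_p intro: order.trans[OF degree_smult_le])
    have cT: "coeff T m = 0" using lc by (simp add: T_def m_def degree_p)
    have "I (T * p n) = 0"
    proof (cases "T = 0")
      case False
      with dT cT have "degree T < m" by (metis le_neq_implies_less leading_coeff_0_iff)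
      then show ?thesis using less.hyps[of T] less.prems by (simp add: m_def)
    qed (simp add: I_0)
    then have "I ((T + smult (lead_coeff R / lead_coeff (p m)) (p m)) * p n) = 0"
      using I_p_p[of m n] \<open>m < n\<close> by (simp add: distrib_right I_add I_smult)
    with R show ?thesis by simp
  qed (simp add: I_0)
qed

lemma orthogonal_to_all:
  assumes "degree R \<le> n" "\<And>k. k \<le> n \<Longrightarrow> I (R * p k) = 0"
  shows "R = 0"
proof (rule ccontr)
  assume R0: "R \<noteq> 0"
  define m where "m = degree R"
  define c where "c = lead_coeff R / lead_coeff (p m)"
  define T where "T = R - smult c (p m)"
  have lc: "coeff (p m) m > 0" using lead_p[of m] degree_p[of m] by simp
  have c0: "c \<noteq> 0" using R0 lead_p[of m] by (auto simp: c_def)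
  have dT: "degree T \<le> m" unfolding T_def
    by (intro degree_diff_le) (auto simp: m_def degree_p intro: order.trans[OF degree_smult_le])
  have cT: "coeff T m = 0" using lc by (simp add: T_def c_def m_def degree_p)
  have "I (T * p m) = 0"
  proof (cases "T = 0")
    case False
    with dT cT have "degree T < m" by (metis le_neq_implies_less leading_coeff_0_iff)
    then show ?thesis by (rule I_low)
  qed (simp add: I_0)
  moreover have "R = T + smult c (p m)" by (simp add: T_def)
  then have "I (R * p m) = I (T * p m) + c" by (simp add: distrib_right I_add I_smult I_p_p)
  ultimately show False using assms(2)[of m] assms(1) c0 by (simp add: m_def)
qed

definition rec_b :: "nat \<Rightarrow> real" where "rec_b n = I (pCons 0 (p n) * p n)"

lemma rec_a_pos: "rec_a p n > 0"
  using lead_p unfolding rec_a_def by simp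

lemma I_X_p_Suc: "I (pCons 0 (p n) * p (Suc n)) = rec_a p (Suc n)"
proof -
  define c where "c = rec_a p (Suc n)"
  define T where "T = pCons 0 (p n) - smult c (p (Suc n))"
  have "degree T \<le> Suc n" unfolding T_def
    by (intro degree_diff_le order.trans[OF degree_smult_le] order.trans[OF degree_pCons_le]) (auto simp: degree_p)
  moreover have "coeff T (Suc n) = 0"
    using lead_p[of "Suc n"] by (simp add: T_def c_def rec_a_def degree_p)
  ultimately have "T = 0 \<or> degree T < Suc n" by (metis le_neq_implies_less leading_coeff_0_iff)
  then have "I (T * p (Suc n)) = 0" using I_low by (auto simp: I_0)
  moreover have "pCons 0 (p n) = T + smult c (p (Suc n))" by (simp add: T_def)
  then have "I (pCons 0 (p n) * p (Suc n)) = I (T * p (Suc n)) + c"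
    by (simp add: distrib_right I_add I_smult I_p_p)
  ultimately show ?thesis by (simp add: c_def)
qed

lemma three_term_recurrence:
  assumes n: "n \<ge> 1"
  shows "smult (rec_a p (Suc n)) (p (Suc n)) = [:- rec_b n, 1:] * p n - smult (rec_a p n) (p (n - 1))"
proof -
  define R where "R = pCons 0 (p n) - smult (rec_b n) (p n) - smult (rec_a p n) (p (n - 1)) - smult (rec_a p (Suc n)) (p (Suc n))"
  have "R = 0"
  proof (cases "R = 0")
    case False
    have "degree R \<le> Suc n" unfolding R_def
      by (intro degree_diff_le order.trans[OF degree_smult_le] order.trans[OF degree_pCons_le]) (auto simp: degree_p)
    moreover have "coeff R (Suc n) = 0"
    proof -
      have "coeff (p n) (Suc n) = 0" "coeff (p (n - 1)) (Suc n) = 0"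
        using n by (auto intro!: coeff_eq_0 simp: degree_p)
      then show ?thesis using lead_p[of "Suc n"] by (simp add: R_def rec_a_def degree_p)
    qed
    ultimately have "degree R < Suc n" using False by (metis le_neq_implies_less leading_coeff_0_iff)
    then have "degree R \<le> n" by simp
    then show "R = 0"
    proof (rule orthogonal_to_all)
      fix k assume k: "k \<le> n"
      have *: "I (R * p k) = I (pCons 0 (p n) * p k) - rec_b n * I (p n * p k) - rec_a p n * I (p (n - 1) * p k)
          - rec_a p (Suc n) * I (p (Suc n) * p k)"
        unfolding R_def by (simp add: left_diff_distrib I_diff I_smult)
      have sym: "I (pCons 0 (p n) * p k) = I (pCons 0 (p k) * p n)" by (simp add: mult.commute)
      consider "k = n" | "k = n - 1" "k \<noteq> n" | "k < n - 1" using k n by linarith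
      then show "I (R * p k) = 0"
      proof cases
        case 1
        then show ?thesis using n unfolding * by (simp add: I_p_p rec_b_def)
      next
        case 2
        then have "n = Suc k" using n by simp
        then show ?thesis unfolding * sym using I_X_p_Suc[of k] by (simp add: I_p_p)
      next
        case 3
        then have "degree (pCons 0 (p k)) < n"
          using degree_pCons_le[of 0 "p k"] degree_p[of k] by simp
        then have "I (pCons 0 (p k) * p n) = 0" by (rule I_low)
        moreover have "n \<noteq> k" "n - 1 \<noteq> k" "Suc n \<noteq> k" using 3 by linarith+
        ultimately show ?thesis unfolding * sym by (simp add: I_p_p)
      qed
    qed
  qed
  then show ?thesis unfolding R_def by (simp add: algebra_simps)
qed

text \<open>
  The part of $R(y) S(y)$ with negative powers of $y$, as a power series in $1/y$. Orthogonality of $p_n$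
  to lower degrees is the vanishing of its first coefficients.
\<close>

definition second_kind_fps :: "real poly \<Rightarrow> complex fps" where
  "second_kind_fps R = Abs_fps (\<lambda>k. if k = 0 then 0 else complex_of_real (I (monom 1 (k - 1) * R)))"

definition second_kind_at :: "real poly \<Rightarrow> complex fls \<Rightarrow> complex fls" where
  "second_kind_at R y = fps_to_fls (fps_compose (second_kind_fps R) (fls_regpart (inverse y)))"

lemma second_kind_1: "second_kind_at 1 y = stieltjes_at \<mu> y"
proof -
  have "second_kind_fps 1 = stieltjes_fps \<mu>"
    by (rule fps_ext) (simp add: second_kind_fps_def stieltjes_fps_def moment_def I_def poly_monom)
  then show ?thesis by (simp add: second_kind_at_def stieltjes_at_def)
qed

lemma second_kind_at_add: "second_kind_at (R + T) y = second_kind_at R y + second_kind_at T y"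
proof -
  have "second_kind_fps (R + T) = second_kind_fps R + second_kind_fps T"
    by (rule fps_ext) (simp add: second_kind_fps_def distrib_left I_add)
  then show ?thesis by (simp add: second_kind_at_def fps_compose_add_distrib)
qed

context
  fixes y :: "complex fls" assumes y: "fls_subdegree y = - 2"
begin

lemma inverse_y: "fls_subdegree (inverse y) = 2" "fps_nth (fls_regpart (inverse y)) 0 = 0"
    "fps_to_fls (fls_regpart (inverse y)) = inverse y"
proof -
  show s: "fls_subdegree (inverse y) = 2" using y by (simp add: fls_inverse_subdegree)
  then show "fps_nth (fls_regpart (inverse y)) 0 = 0" by simp
  show "fps_to_fls (fls_regpart (inverse y)) = inverse y"
    using s by (intro fls_regpart_to_fls_trivial) simp
qed

lemma second_kind_at_smult: "second_kind_at (smult c R) y = fls_const (complex_of_real c) * second_kind_at R y"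
proof -
  have "second_kind_fps (smult c R) = fps_const (complex_of_real c) * second_kind_fps R"
    by (rule fps_ext) (simp add: second_kind_fps_def I_smult)
  then show ?thesis using inverse_y
    by (simp add: second_kind_at_def fps_compose_mult_distrib fls_times_fps_to_fls)
qed

lemma second_kind_at_pCons:
  "second_kind_at (pCons 0 R) y = y * second_kind_at R y - fls_const (complex_of_real (I R))"
proof -
  let ?w = "fls_regpart (inverse y)"
  have "second_kind_fps R = fps_X * (fps_const (complex_of_real (I R)) + second_kind_fps (pCons 0 R))"
  proof (rule fps_ext)
    fix k
    show "fps_nth (second_kind_fps R) k = fps_nth (fps_X * (fps_const (complex_of_real (I R)) + second_kind_fps (pCons 0 R))) k"
    proof (cases k)
      case (Suc j)
      show ?thesis
      proof (cases j)
        case 0 with Suc show ?thesis by (simp add: second_kind_fps_def flip: one_pCons)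
      next
        case (Suc i)
        have "monom 1 i * pCons 0 R = monom 1 (Suc i) * R" by (simp add: monom_Suc)
        with Suc \<open>k = Suc j\<close> show ?thesis by (simp add: second_kind_fps_def)
      qed
    qed (simp add: second_kind_fps_def)
  qed
  then have "fps_compose (second_kind_fps R) ?w = ?w * (fps_const (complex_of_real (I R)) + fps_compose (second_kind_fps (pCons 0 R)) ?w)"
    using inverse_y(2) by (simp add: fps_compose_mult_distrib fps_compose_add_distrib)
  then have "second_kind_at R y = inverse y * (fls_const (complex_of_real (I R)) + second_kind_at (pCons 0 R) y)"
    unfolding second_kind_at_def by (simp only: fls_times_fps_to_fls inverse_y(3) fps_to_fls_plus) simp
  moreover have "y \<noteq> 0" using y by auto
  ultimately show ?thesis by (simp add: field_simps)
qed

lemma second_kind_p_small: "ord_ge (2 * int n) (second_kind_at (p n) y)"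
proof -
  have z: "fps_nth (second_kind_fps (p n)) k = 0" if "k < n" for k
  proof (cases k)
    case (Suc j)
    then have "degree (monom (1::real) j) < n" using that by (simp add: degree_monom_eq)
    then show ?thesis using Suc I_low by (simp add: second_kind_fps_def)
  qed (simp add: second_kind_fps_def)
  show ?thesis
  proof (cases "second_kind_fps (p n) = 0")
    case False
    then have "n \<le> subdegree (second_kind_fps (p n))" using z by (intro subdegree_geI) auto
    moreover have "subdegree (fls_regpart (inverse y)) = 2"
      using inverse_y(1) by (simp add: fls_regpart_subdegree_conv)
    ultimately show ?thesis
      unfolding ord_ge_def second_kind_at_def
      using inverse_y(2) by (simp add: fls_subdegree_fls_to_fps mult.commute)
  qed (simp add: second_kind_at_def ord_ge_def)
qed

end

abbreviation "a n \<equiv> complex_of_real (rec_a p n)"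
abbreviation "b n \<equiv> complex_of_real (rec_b n)"
abbreviation "cp R \<equiv> map_poly complex_of_real R"

text \<open>
  The numerator polynomials, generated by the recurrence. The value at index $1$ is the constant term that
  splits off in $y\,S(y) = \mu_0 + \dots$, scaled by the leading coefficient of $p_1$.
\<close>

fun second_poly :: "nat \<Rightarrow> complex poly" where
  "second_poly 0 = 0"
| "second_poly (Suc 0) = [:complex_of_real (lead_coeff (p 1) * I 1):]"
| "second_poly (Suc (Suc n)) = smult (1 / a (Suc (Suc n)))
     ([:- b (Suc n), 1:] * second_poly (Suc n) - smult (a (Suc n)) (second_poly n))"

lemma second_poly_recurrence:
  assumes "n \<ge> 1"
  shows "smult (a (Suc n)) (second_poly (Suc n)) = [:- b n, 1:] * second_poly n - smult (a n) (second_poly (n - 1))"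
  using assms rec_a_pos[of "Suc n"] by (cases n) (auto simp: less_le)

lemma complex_recurrence:
  assumes "n \<ge> 1"
  shows "smult (a (Suc n)) (cp (p (Suc n))) = [:- b n, 1:] * cp (p n) - smult (a n) (cp (p (n - 1)))"
proof -
  have s: "cp (smult c R) = smult (complex_of_real c) (cp R)" for c R
    by (rule poly_eqI) (simp add: coeff_map_poly)
  have m: "cp ([:c, 1:] * R) = [:complex_of_real c, 1:] * cp R" for c R
    by (rule poly_eqI) (simp add: coeff_map_poly coeff_pCons split: nat.split)
  have d: "cp (R - T) = cp R - cp T" for R T
    by (rule poly_eqI) (simp add: coeff_map_poly)
  from arg_cong[OF three_term_recurrence[OF assms], of cp] show ?thesis
    unfolding s d m by simp
qed

text \<open>
  Both sides solve the recurrence: in \<open>second_kind_at_pCons\<close> the extra constant is $\int p_n\,d\mu$,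
  which is zero for $n \ge 1$.
\<close>

lemma remainder:
  assumes y: "fls_subdegree y = - 2"
  shows "poly_at (cp (p n)) y * stieltjes_at \<mu> y - poly_at (second_poly n) y = second_kind_at (p n) y"
proof (induction n rule: second_poly.induct)
  case 1
  obtain c where c: "p 0 = [:c:]" using degree_p[of 0] degree_eq_zeroE by blast
  have "second_kind_at (smult c 1) y = fls_const (complex_of_real c) * stieltjes_at \<mu> y"
    unfolding second_kind_at_smult[OF y] second_kind_1 ..
  then show ?case by (simp add: c map_poly_pCons one_pCons)
next
  case 2
  obtain c0 c1 where c: "p 1 = [:c0, c1:]" "c1 \<noteq> 0"
  proof -
    obtain c0 R where R: "p 1 = pCons c0 R" by (meson pCons_cases)
    with degree_p[of 1] have "R \<noteq> 0" "degree R = 0" by (auto split: if_splits)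
    then show thesis using that R by (metis degree_eq_zeroE pCons_0_0)
  qed
  have "p 1 = smult c0 1 + smult c1 (pCons 0 1)" unfolding c by (simp add: one_pCons)
  then have "second_kind_at (p 1) y = fls_const (complex_of_real c0) * stieltjes_at \<mu> y
      + fls_const (complex_of_real c1) * (y * stieltjes_at \<mu> y - fls_const (complex_of_real (I 1)))"
    by (simp only: second_kind_at_add second_kind_at_smult[OF y] second_kind_at_pCons[OF y] second_kind_1)
  moreover have "poly_at (cp (p 1)) y = fls_const (complex_of_real c0) + y * fls_const (complex_of_real c1)"
    unfolding c by (simp add: map_poly_pCons poly_at_pCons)
  moreover have "poly_at (second_poly 1) y = fls_const (complex_of_real c1) * fls_const (complex_of_real (I 1))"
    using c by simp
  ultimately show ?case unfolding One_nat_def by algebra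
next
  case (3 n)
  let ?a = "fls_const (a (Suc (Suc n)))" and ?c = "fls_const (a (Suc n))" and ?b = "fls_const (b (Suc n))"
  have lin: "poly_at [:- b (Suc n), 1:] y = y - ?b"
    using poly_at_minus[of "[:b (Suc n):]" y] by (simp add: poly_at_pCons)
  have P: "?a * poly_at (cp (p (Suc (Suc n)))) y = (y - ?b) * poly_at (cp (p (Suc n))) y - ?c * poly_at (cp (p n)) y"
    using arg_cong[OF complex_recurrence[of "Suc n"], of "\<lambda>R. poly_at R y"] by (simp only: poly_at_smult poly_at_diff poly_at_mult lin) simp
  have Q: "?a * poly_at (second_poly (Suc (Suc n))) y = (y - ?b) * poly_at (second_poly (Suc n)) y - ?c * poly_at (second_poly n) y"
    using arg_cong[OF second_poly_recurrence[of "Suc n"], of "\<lambda>R. poly_at R y"]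
    by (simp only: poly_at_smult poly_at_diff poly_at_mult lin) simp
  have "I (p (Suc n)) = 0"
  proof -
    have "I (1 * p (Suc n)) = 0" by (rule I_low) simp
    then show ?thesis by simp
  qed
  moreover have "smult (rec_a p (Suc (Suc n))) (p (Suc (Suc n))) = pCons 0 (p (Suc n)) + smult (- rec_b (Suc n)) (p (Suc n)) + smult (- rec_a p (Suc n)) (p n)"
    using three_term_recurrence[of "Suc n"] by (simp add: algebra_simps)
  from arg_cong[OF this, of "\<lambda>R. second_kind_at R y"]
  have "?a * second_kind_at (p (Suc (Suc n))) y = y * second_kind_at (p (Suc n)) y - fls_const (complex_of_real (I (p (Suc n))))
     + fls_const (- b (Suc n)) * second_kind_at (p (Suc n)) y + fls_const (- a (Suc n)) * second_kind_at (p n) y"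
    by (simp only: second_kind_at_add second_kind_at_smult[OF y] second_kind_at_pCons[OF y] of_real_minus)
  ultimately have Z: "?a * second_kind_at (p (Suc (Suc n))) y = (y - ?b) * second_kind_at (p (Suc n)) y - ?c * second_kind_at (p n) y"
    by (simp add: algebra_simps)
  have "?a * (poly_at (cp (p (Suc (Suc n)))) y * stieltjes_at \<mu> y - poly_at (second_poly (Suc (Suc n))) y)
      = ?a * second_kind_at (p (Suc (Suc n))) y"
    using P Q Z 3 by algebra
  moreover have "?a \<noteq> 0" using rec_a_pos[of "Suc (Suc n)"] by simp
  ultimately show ?case by (metis mult_left_cancel)
qed

lemma casoratian_start: "\<exists>\<kappa>. \<kappa> \<noteq> 0 \<and> cp (p 0) * second_poly 1 - cp (p 1) * second_poly 0 = [:\<kappa>:]"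
proof -
  obtain c where c: "p 0 = [:c:]" using degree_p[of 0] degree_eq_zeroE by blast
  have c0: "c > 0" using lead_p[of 0] by (simp add: c)
  have "1 = c * c * I 1" using I_p_p[of 0 0] I_smult[of "c * c" 1] by (simp add: c one_pCons)
  then have "I 1 \<noteq> 0" by auto
  then have "complex_of_real (c * (lead_coeff (p 1) * I 1)) \<noteq> 0"
    using c0 lead_p[of 1] by (metis mult_eq_0_iff of_real_eq_0_iff order_less_irrefl)
  moreover have "cp (p 0) * second_poly 1 - cp (p 1) * second_poly 0 = [:complex_of_real (c * (lead_coeff (p 1) * I 1)):]"
    by (simp add: c map_poly_pCons)
  ultimately show ?thesis by blast
qed

end

section \<open>From first-order difference relations to the Stieltjes function\<close>

theorem mainTheorem1:
  fixes A B C D E F :: complex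
    and \<phi>1 \<phi>2 :: "complex fls"
    and \<mu> :: "real measure"
    and p :: "nat \<Rightarrow> real poly"
    and W \<Omega> \<Theta> :: "nat \<Rightarrow> complex poly"
    and dW d\<Omega> d\<Theta> :: nat
  assumes "A * C \<noteq> 0"
    and "conic_expr A B C D E F x_inf \<phi>1 = 0"
    and "conic_expr A B C D E F x_inf \<phi>2 = 0"
    and "\<phi>1 \<noteq> \<phi>2"
    and "sets \<mu> = sets borel"
    and "infinite (measure_support \<mu>)"
    and "\<And>k. integrable \<mu> (\<lambda>t. t ^ k)"
    and "orthonormal_polys \<mu> p"
    and "\<And>n. n \<ge> 1 \<Longrightarrow> \<not> (W n = 0 \<and> \<Omega> n = 0 \<and> \<Theta> n = 0)"
    and "\<And>n. n \<ge> 1 \<Longrightarrow> degree (W n) = dW \<and> degree (\<Omega> n) = d\<Omega> \<and> degree (\<Theta> n) = d\<Theta>"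
    and "\<And>n. n \<ge> 1 \<Longrightarrow>
           poly_at (W n) x_inf *
             divided_difference \<phi>1 \<phi>2 (poly_at (map_poly complex_of_real (p n))) =
           poly_at (\<Omega> n) x_inf *
             arithmetic_mean \<phi>1 \<phi>2 (poly_at (map_poly complex_of_real (p n))) -
           fls_const (complex_of_real (rec_a p n)) * poly_at (\<Theta> n) x_inf *
             arithmetic_mean \<phi>1 \<phi>2 (poly_at (map_poly complex_of_real (p (n - 1))))"
  shows "D_semi_classical \<phi>1 \<phi>2 \<mu>"
proof -
  interpret lattice: conic A B C D E F \<phi>1 \<phi>2
    by unfold_locales fact+
  interpret ortho: orthonormal_sequence \<mu> p
    by unfold_locales fact+
  define P where "P n = map_poly complex_of_real (p n)" for n
  note sub = lattice.subdegree_roots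
  interpret first_order_relation A B C D E F \<phi>1 \<phi>2 ortho.a ortho.b P ortho.second_poly
    "stieltjes_at \<mu> \<phi>1" "stieltjes_at \<mu> \<phi>2" W \<Omega> \<Theta> "dW + d\<Omega> + d\<Theta>"
  proof unfold_locales
    fix n :: nat
    show deg: "degree (P n) = n"
      unfolding P_def using ortho.degree_p[of n] by (simp add: degree_map_poly)
    show "P 0 \<noteq> 0"
      unfolding P_def using ortho.lead_p[of 0] by (auto simp: map_poly_eq_0_iff)
    show "\<exists>\<kappa>. \<kappa> \<noteq> 0 \<and> P 0 * ortho.second_poly 1 - P 1 * ortho.second_poly 0 = [:\<kappa>:]"
      unfolding P_def by (rule ortho.casoratian_start)
    show "ord_ge (2 * int n) (poly_at (P n) \<phi>1 * stieltjes_at \<mu> \<phi>1 - poly_at (ortho.second_poly n) \<phi>1)"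
      "ord_ge (2 * int n) (poly_at (P n) \<phi>2 * stieltjes_at \<mu> \<phi>2 - poly_at (ortho.second_poly n) \<phi>2)"
      unfolding P_def ortho.remainder[OF sub(1)] ortho.remainder[OF sub(2)]
      by (rule ortho.second_kind_p_small[OF sub(1)], rule ortho.second_kind_p_small[OF sub(2)])
    assume n: "n \<ge> 1"
    show "ortho.a n \<noteq> 0"
      using ortho.rec_a_pos[of n] by simp
    show "smult (ortho.a (Suc n)) (P (Suc n)) = [:- ortho.b n, 1:] * P n - smult (ortho.a n) (P (n - 1))"
      unfolding P_def by (rule ortho.complex_recurrence[OF n])
    show "smult (ortho.a (Suc n)) (ortho.second_poly (Suc n))
        = [:- ortho.b n, 1:] * ortho.second_poly n - smult (ortho.a n) (ortho.second_poly (n - 1))"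
      by (rule ortho.second_poly_recurrence[OF n])
    show "\<not> (W n = 0 \<and> \<Omega> n = 0 \<and> \<Theta> n = 0)"
      by (rule assms(9)[OF n])
    show "degree (W n) \<le> dW + d\<Omega> + d\<Theta> \<and> degree (\<Omega> n) \<le> dW + d\<Omega> + d\<Theta> \<and> degree (\<Theta> n) \<le> dW + d\<Omega> + d\<Theta>"
      using assms(10)[OF n] by simp
    define u v u' v' where "u = poly_at (P n) \<phi>1" and "v = poly_at (P n) \<phi>2"
      and "u' = poly_at (P (n - 1)) \<phi>1" and "v' = poly_at (P (n - 1)) \<phi>2"
    define w \<omega> \<theta> where "w = poly_at (W n) x_inf" and "\<omega> = poly_at (\<Omega> n) x_inf"
      and "\<theta> = fls_const (ortho.a n) * poly_at (\<Theta> n) x_inf"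
    have eq: "w * ((v - u) / lattice.\<delta>) = \<omega> * ((u + v) / 2) - \<theta> * ((u' + v') / 2)"
      using assms(11)[OF n] unfolding divided_difference_def arithmetic_mean_def lattice.\<delta>_def
        w_def \<omega>_def \<theta>_def u_def v_def u'_def v'_def P_def .
    define q where "q = (v - u) / lattice.\<delta>"
    have q: "v - u = lattice.\<delta> * q"
      using lattice.\<delta>_nz by (simp add: q_def)
    define s s' where "s = (u + v) / 2" and "s' = (u' + v') / 2"
    have s: "u + v = 2 * s" "u' + v' = 2 * s'"
      by (simp_all add: s_def s'_def)
    have eq': "w * q = \<omega> * s - \<theta> * s'"
      using eq unfolding q_def s_def s'_def .
    have "2 * w * (v - u) - lattice.\<delta> * \<omega> * (v + u) + lattice.\<delta> * \<theta> * (v' + u') = 0"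
      using eq' q s by algebra
    then show "2 * poly_at (W n) x_inf * (poly_at (P n) \<phi>2 - poly_at (P n) \<phi>1)
        - lattice.\<delta> * poly_at (\<Omega> n) x_inf * (poly_at (P n) \<phi>2 + poly_at (P n) \<phi>1)
        + fls_const (ortho.a n) * lattice.\<delta> * poly_at (\<Theta> n) x_inf
          * (poly_at (P (n - 1)) \<phi>2 + poly_at (P (n - 1)) \<phi>1) = 0"
      unfolding w_def \<omega>_def \<theta>_def u_def v_def u'_def v'_def by (simp only: ac_simps)
  qed
  show ?thesis
    unfolding D_semi_classical_def divided_difference_def arithmetic_mean_def by (rule semi_classical)
qed

end
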